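(* Let $n\ge 1$ and let $Y=\{xz=y(y+t^n)\}\subset\mathbb{A}^4_{x,y,z,t}$, $P=0\in Y$, with reduced divisor $D=D_1+D_2+D_3$, where $D_1=\{x=y=0\}$, $D_2=\{y=z=0\}$, $D_3=\{t=0,\ xz=y^2\}$. Let $$f\colon X=\{\,y\alpha=z\beta,\ x\alpha=(y+t^n)\beta\,\}\subset\mathbb{A}^4_{x,y,z,t}\times\mathbb{P}^1_{\alpha:\beta}\longrightarrow Y$$ be the flopping extraction over $P$, and let $\widetilde D=\widetilde D_1+\widetilde D_2+\widetilde D_3\subset X$ be the strict transform of $D$. Then the intersection complex of $(X,\widetilde D)$ is dual to the left-hand subdivision $\sigma=\tau_1\cup\tau_2$ of the cone $\sigma\subset U^{\mathrm{trop}}$ described in the context, where the rays $\rho_1,\rho_2,\rho_3$ of $\sigma$ correspond to the boundary divisors $\widetilde D_1,\widetilde D_2,\widetilde D_3$ respectively, and the subdividing plane $\Pi_L$ corresponds to the exceptional curve $C=f^{-1}(P)$. Moreover, the right-hand subdivision of $\sigma$ described in the context is dual to the intersection complex of $(X',\widetilde D')$, where $f'\colon X'\to Y$ is the other flopping extraction from $P\in Y$ and $\widetilde D'$ is the strict transform of $D$ in $X'$.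
   Context: Work over $\mathbb{C}$. The map $f\colon X\to Y$ is the small resolution obtained by blowing up the Weil divisor $D_2$; the other flopping extraction $f'\colon X'\to Y$ is the blowup of the Weil divisor $D_1$. These are the two sides of the flop over $P\in Y$. Integral affine manifold $U^{\mathrm{trop}}$. Its underlying manifold is $N_{\mathbb{R}}=\mathbb{R}^3$ with coordinates $(a,b,c)$ and its integral points are $\mathbb{Z}^3$. Let $H=\{b=nc\}$, $\ell=\mathbb{R}(n,n,1)\subset H$, $H^{+}=\{v+s(1,0,0): v\in\ell, s>0\}$, $H^-=\{v-s(1,0,0): v\in\ell,s>0\}$. The integral affine structure on $\mathbb{R}^3\setminus\ell$ is the standard one off $H^+$, and the tangent vector of a straight line is multiplied by $$M_\ell=\begin{pmatrix}1&1&-n\\0&1&0\\0&0&1\end{pmatrix}$$ (resp. $M_\ell^{-1}$) when it crosses $H^+$ in the direction of increasing (resp. decreasing) $-b+nc$. The cone $\sigma$. Let $\sigma=\{(a,b,c): a\ge 0,\ c\ge 0,\ a\le 2b,\ a\le b+nc\}$. It has three rays $\rho_i=\mathbb{R}_{\ge0}d_i$, with $d_1=(1,1,0)$, $d_2=(0,1,0)$, $d_3=(0,0,1)$, and three two-dimensional faces: $\sigma\cap\{a=0\}$ (containing $\rho_2,\rho_3$), $\sigma\cap\{c=0\}$ (containing $\rho_1,\rho_2$), and the bent face $\sigma\cap\{a=b+\min(b,nc)\}$ (containing $\rho_1,\rho_3$), which is a single flat face for the integral affine structure of $U^{\mathrm{trop}}$. Angle brackets denote the convex cone in $\mathbb{R}^3$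 generated by the listed vectors or rays. Left-hand subdivision: put $\ell_+=\mathbb{R}_{\ge0}(n,n,1)$, let $\Pi_L=\langle\rho_2,\ell_+\rangle\cup\langle\ell_+,\rho_3\rangle$ be the subdividing plane between $\rho_2$ and $\rho_3$, and let $\tau_1=\langle\rho_2,\rho_3,\ell_+\rangle$ and $\tau_2=\overline{\sigma\setminus\tau_1}$. The cells of the subdivision are the maximal cells $\tau_1,\tau_2$, the two-dimensional cells $\Pi_L$ and the three two-dimensional faces of $\sigma$, and the rays $\rho_1,\rho_2,\rho_3$ (so $\ell_+$ is not a cell). Right-hand subdivision: let $\Pi_R=\langle\rho_1,\rho_3\rangle=\sigma\cap\{a=b\}$ (which contains $\ell_+$). The cells are the maximal cells $\langle\rho_1,\rho_2,\rho_3\rangle$ and $\overline{\sigma\setminus\langle\rho_1,\rho_2,\rho_3\rangle}$, the two-dimensional cells $\Pi_R$ and the three two-dimensional faces of $\sigma$, and the rays $\rho_1,\rho_2,\rho_3$. Intersection complex: the strata of a boundary divisor $\sum_i\widetilde D_i$ in a threefold are the components $\widetilde D_i$ (dimension 2), the irreducible components of the intersections $\widetilde D_i\cap\widetilde D_j$, $i\ne j$ (dimension 1), and the points lying on at least two of these one-dimensional strata (dimension 0), ordered by inclusion. It is dual to a subdivision of $\sigma$ if there is an inclusion-reversing bijection between strata and cells that matches strata of dimension $k$ with cells of dimension $3-k$. *)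

theory Defs
  imports "HOL-Analysis.Analysis"
begin

section \<open>The projective line and the Zariski topology on \<open>A\<^sup>4 \<times> P\<^sup>1\<close>\<close>

text \<open>Varieties over the complex numbers are represented by their sets of closed points.\<close>

type_synonym aff4 = "complex \<times> complex \<times> complex \<times> complex"

definition proj1_rel :: "complex \<times> complex \<Rightarrow> complex \<times> complex \<Rightarrow> bool" where
  "proj1_rel u v \<longleftrightarrow> u \<noteq> (0, 0) \<and> (\<exists>c. c \<noteq> 0 \<and> v = (c * fst u, c * snd u))"

quotient_type proj1 = "complex \<times> complex" / partial: proj1_rel
proof (rule part_equivpI)
  show "\<exists>u. proj1_rel u u"
    by (rule exI[of _ "(1, 0)"]) (auto simp: proj1_rel_def intro!: exI[of _ 1])
  show "symp proj1_rel"
  proof (rule sympI)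
    fix u v assume "proj1_rel u v"
    then obtain c where "u \<noteq> (0, 0)" "c \<noteq> 0" "v = (c * fst u, c * snd u)"
      by (auto simp: proj1_rel_def)
    then show "proj1_rel v u"
      by (cases u) (auto simp: proj1_rel_def intro!: exI[of _ "inverse c"])
  qed
  show "transp proj1_rel"
  proof (rule transpI)
    fix u v w assume "proj1_rel u v" "proj1_rel v w"
    then obtain c d where "u \<noteq> (0, 0)" "c \<noteq> 0" "v = (c * fst u, c * snd u)"
      "d \<noteq> 0" "w = (d * fst v, d * snd v)"
      unfolding proj1_rel_def by blast
    then show "proj1_rel u w"
      by (auto simp: proj1_rel_def intro!: exI[of _ "d * c"])
  qed
qed

text \<open>The point \<open>[\<alpha> : \<beta>]\<close>; meaningful only when \<open>(\<alpha>, \<beta>) \<noteq> (0, 0)\<close>.\<close>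

definition hom_pt :: "complex \<Rightarrow> complex \<Rightarrow> proj1" where
  "hom_pt \<alpha> \<beta> = abs_proj1 (\<alpha>, \<beta>)"

inductive poly_fun :: "(aff4 \<Rightarrow> complex) \<Rightarrow> bool" where
  const: "poly_fun (\<lambda>_. c)"
| coord_x: "poly_fun (\<lambda>(x, y, z, t). x)"
| coord_y: "poly_fun (\<lambda>(x, y, z, t). y)"
| coord_z: "poly_fun (\<lambda>(x, y, z, t). z)"
| coord_t: "poly_fun (\<lambda>(x, y, z, t). t)"
| add: "poly_fun g \<Longrightarrow> poly_fun h \<Longrightarrow> poly_fun (\<lambda>p. g p + h p)"
| mult: "poly_fun g \<Longrightarrow> poly_fun h \<Longrightarrow> poly_fun (\<lambda>p. g p * h p)"

text \<open>The zero locus of \<open>\<Sum>i\<le>d. g\<^sub>i(x,y,z,t) \<alpha>\<^sup>i \<beta>\<^bsup>d-i\<^esup>\<close>, the general polynomial which is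
  homogeneous of degree \<open>d\<close> in \<open>\<alpha>, \<beta>\<close>.\<close>

definition form_zeros :: "nat \<Rightarrow> (nat \<Rightarrow> aff4 \<Rightarrow> complex) \<Rightarrow> (aff4 \<times> proj1) set" where
  "form_zeros d g = {(p, hom_pt \<alpha> \<beta>) | p \<alpha> \<beta>.
     (\<alpha>, \<beta>) \<noteq> (0, 0) \<and> (\<Sum>i\<le>d. g i p * \<alpha> ^ i * \<beta> ^ (d - i)) = 0}"

definition zariski_closed :: "(aff4 \<times> proj1) set \<Rightarrow> bool" where
  "zariski_closed A \<longleftrightarrow>
     (\<exists>F. (\<forall>(d, g) \<in> F. \<forall>i. poly_fun (g i)) \<and> A = (\<Inter>(d, g) \<in> F. form_zeros d g))"

definition irreducible_set :: "(aff4 \<times> proj1) set \<Rightarrow> bool" where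
  "irreducible_set T \<longleftrightarrow> T \<noteq> {} \<and>
     (\<forall>A B. zariski_closed A \<and> zariski_closed B \<and> T \<subseteq> A \<union> B \<longrightarrow> T \<subseteq> A \<or> T \<subseteq> B)"

definition irreducible_components :: "(aff4 \<times> proj1) set \<Rightarrow> (aff4 \<times> proj1) set set" where
  "irreducible_components S =
     {T. T \<subseteq> S \<and> irreducible_set T \<and> (\<forall>T'. T \<subseteq> T' \<and> T' \<subseteq> S \<and> irreducible_set T' \<longrightarrow> T' = T)}"


section \<open>The singularity, its boundary and the two flopping extractions\<close>

definition Y :: "nat \<Rightarrow> aff4 set" where
  "Y n = {(x, y, z, t). x * z = y * (y + t ^ n)}"

definition P :: aff4 where
  "P = (0, 0, 0, 0)"

definition D :: "nat \<Rightarrow> nat \<Rightarrow> aff4 set" where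
  "D n i = {(x, y, z, t). (x, y, z, t) \<in> Y n \<and>
     (if i = 1 then x = 0 \<and> y = 0
      else if i = 2 then y = 0 \<and> z = 0
      else t = 0 \<and> x * z = y ^ 2)}"

text \<open>The morphisms to \<open>Y n\<close> are the restrictions of the first projection \<open>fst\<close>.\<close>

definition X :: "nat \<Rightarrow> (aff4 \<times> proj1) set" where
  "X n = {((x, y, z, t), hom_pt \<alpha> \<beta>) | x y z t \<alpha> \<beta>.
     (\<alpha>, \<beta>) \<noteq> (0, 0) \<and> y * \<alpha> = z * \<beta> \<and> x * \<alpha> = (y + t ^ n) * \<beta>}"

text \<open>The blowup of a subvariety \<open>V\<close> of affine space along the ideal generated by \<open>g\<close> and \<open>h\<close>, as
  the Zariski closure of the graph of the rational map \<open>[g : h]\<close>.\<close>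

definition blowup :: "aff4 set \<Rightarrow> (aff4 \<Rightarrow> complex) \<Rightarrow> (aff4 \<Rightarrow> complex) \<Rightarrow> (aff4 \<times> proj1) set" where
  "blowup V g h = zariski_closed hull
     {(p, hom_pt (g p) (h p)) | p. p \<in> V \<and> (g p, h p) \<noteq> (0, 0)}"

text \<open>The ideal of the Weil divisor \<open>D n 1\<close> in the coordinate ring of \<open>Y n\<close> is \<open>(x, y)\<close>.\<close>

definition X' :: "nat \<Rightarrow> (aff4 \<times> proj1) set" where
  "X' n = blowup (Y n) (\<lambda>(x, y, z, t). x) (\<lambda>(x, y, z, t). y)"

definition fibre_P :: "(aff4 \<times> proj1) set \<Rightarrow> (aff4 \<times> proj1) set" where
  "fibre_P Z = {w \<in> Z. fst w = P}"

text \<open>Both extractions are isomorphisms exactly over the complement of \<open>P\<close>, so the strict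
  transform is the closure of the preimage of \<open>E - {P}\<close>.\<close>

definition strict_transform :: "(aff4 \<times> proj1) set \<Rightarrow> aff4 set \<Rightarrow> (aff4 \<times> proj1) set" where
  "strict_transform Z E = zariski_closed hull {w \<in> Z. fst w \<in> E - {P}}"

text \<open>The strata of dimension \<open>k\<close> of the intersection complex of a boundary divisor with
  components \<open>E i\<close>, \<open>i \<in> I\<close>, in a threefold.\<close>

definition curve_strata :: "nat set \<Rightarrow> (nat \<Rightarrow> (aff4 \<times> proj1) set) \<Rightarrow> (aff4 \<times> proj1) set set" where
  "curve_strata I E =
     (\<Union>i\<in>I. \<Union>j\<in>I - {i}. irreducible_components (E i \<inter> E j))"

definition strata :: "nat set \<Rightarrow> (nat \<Rightarrow> (aff4 \<times> proj1) set) \<Rightarrow> nat \<Rightarrow> (aff4 \<times> proj1) set set" where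
  "strata I E k =
     (if k = 2 then E ` I
      else if k = 1 then curve_strata I E
      else if k = 0 then
        {{w} | w. \<exists>S\<in>curve_strata I E. \<exists>T\<in>curve_strata I E. S \<noteq> T \<and> w \<in> S \<and> w \<in> T}
      else {})"


section \<open>The integral affine manifold and the two subdivisions\<close>

type_synonym trop = "real \<times> real \<times> real"

definition M_ell :: "nat \<Rightarrow> trop \<Rightarrow> trop" where
  "M_ell n = (\<lambda>(a, b, c). (a + b - real n * c, b, c))"

text \<open>With \<open>\<ell> = \<real>(n,n,1)\<close> and \<open>H\<^sup>\<plusminus> = \<ell> \<plusminus> \<real>\<^bsub>>0\<^esub>(1,0,0)\<close>, the integral affine structure has two
  charts: the identity, on the complement of \<open>H\<^sup>+ \<union> \<ell>\<close>, and the map \<open>chart_H\<close> below, on the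
  complement of \<open>H\<^sup>- \<union> \<ell>\<close>. A straight line crossing \<open>H\<^sup>+\<close> towards increasing \<open>-b+nc\<close> has its
  tangent vector multiplied by \<open>M_ell n\<close>; \<open>chart_H\<close> undoes this on the far side, so that it
  takes such a line to an ordinary straight line. Both maps extend continuously over \<open>\<ell>\<close>.\<close>

definition chart_H :: "nat \<Rightarrow> trop \<Rightarrow> trop" where
  "chart_H n = (\<lambda>(a, b, c). if - b + real n * c \<le> 0 then (a, b, c) else inv (M_ell n) (a, b, c))"

text \<open>A cell may look bent in one of the two charts while being flat in the other (the face
  \<open>a = b + min b (nc)\<close> and the plane \<open>Pi_L\<close> are bent in the identity chart and flat in
  \<open>chart_H\<close>; the face \<open>a = 0\<close> is flat in the identity chart only). Its dimension is that of
  its linear span in a chart where it is flat, which is the smaller of the two spans.\<close>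

definition trop_dim :: "nat \<Rightarrow> trop set \<Rightarrow> nat" where
  "trop_dim n S = min (dim S) (dim (chart_H n ` S))"

definition trop_sigma :: "nat \<Rightarrow> trop set" where
  "trop_sigma n = {(a, b, c). a \<ge> 0 \<and> c \<ge> 0 \<and> a \<le> 2 * b \<and> a \<le> b + real n * c}"

definition gen :: "nat \<Rightarrow> trop" where
  "gen i = (if i = 1 then (1, 1, 0) else if i = 2 then (0, 1, 0) else (0, 0, 1))"

definition ray :: "nat \<Rightarrow> trop set" where
  "ray i = {s *\<^sub>R gen i | s. s \<ge> 0}"

definition ell_plus :: "nat \<Rightarrow> trop set" where
  "ell_plus n = {s *\<^sub>R (real n, real n, 1) | s. s \<ge> 0}"

definition sigma_faces :: "nat \<Rightarrow> trop set set" where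
  "sigma_faces n =
     {trop_sigma n \<inter> {(a, b, c). a = 0},
      trop_sigma n \<inter> {(a, b, c). c = 0},
      trop_sigma n \<inter> {(a, b, c). a = b + min b (real n * c)}}"

definition Pi_L :: "nat \<Rightarrow> trop set" where
  "Pi_L n = convex_cone hull (ray 2 \<union> ell_plus n) \<union> convex_cone hull (ell_plus n \<union> ray 3)"

definition tau1 :: "nat \<Rightarrow> trop set" where
  "tau1 n = convex_cone hull (ray 2 \<union> ray 3 \<union> ell_plus n)"

definition tau2 :: "nat \<Rightarrow> trop set" where
  "tau2 n = closure (trop_sigma n - tau1 n)"

definition cells_L :: "nat \<Rightarrow> trop set set" where
  "cells_L n = {tau1 n, tau2 n} \<union> {Pi_L n} \<union> sigma_faces n \<union> {ray 1, ray 2, ray 3}"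

definition Pi_R :: "trop set" where
  "Pi_R = convex_cone hull (ray 1 \<union> ray 3)"

definition simplex_R :: "trop set" where
  "simplex_R = convex_cone hull (ray 1 \<union> ray 2 \<union> ray 3)"

definition cells_R :: "nat \<Rightarrow> trop set set" where
  "cells_R n = {simplex_R, closure (trop_sigma n - simplex_R)} \<union> {Pi_R} \<union> sigma_faces n
     \<union> {ray 1, ray 2, ray 3}"

text \<open>\<open>\<phi>\<close> exhibits the subdivision with the given cells as dual to the intersection complex of
  the boundary divisor with components \<open>E i\<close>, \<open>i \<in> I\<close>.\<close>

definition duality ::
    "nat \<Rightarrow> trop set set \<Rightarrow> nat set \<Rightarrow> (nat \<Rightarrow> (aff4 \<times> proj1) set) \<Rightarrow>
     (trop set \<Rightarrow> (aff4 \<times> proj1) set) \<Rightarrow> bool" where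
  "duality n cells I E \<phi> \<longleftrightarrow>
     bij_betw \<phi> cells (\<Union>k\<le>2. strata I E k) \<and>
     (\<forall>c\<in>cells. \<forall>c'\<in>cells. c \<subseteq> c' \<longleftrightarrow> \<phi> c' \<subseteq> \<phi> c) \<and>
     (\<forall>k\<le>2. \<phi> ` {c \<in> cells. trop_dim n c = 3 - k} = strata I E k)"

end

theory Submission
  imports Defs
begin

text \<open>Everything is explicit. On \<open>X\<close> the chart \<open>\<alpha> = 1\<close> has coordinates \<open>(z, t, \<beta>)\<close> and the chart
  \<open>\<beta> = 1\<close> has coordinates \<open>(x, t, \<alpha>)\<close>; both are affine three-spaces. The strict transform of
  \<open>D\<^sub>1\<close> is the plane \<open>x = y = 0\<close>, \<open>\<beta> = 0\<close>, which meets the exceptional curve \<open>C\<close> only in the point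
  \<open>[1 : 0]\<close>, whereas the strict transforms \<open>y = z = 0\<close>, \<open>x\<alpha> = t\<^sup>n\<beta>\<close> of \<open>D\<^sub>2\<close> and \<open>t = 0\<close>,
  \<open>y\<alpha> = z\<beta>\<close>, \<open>x\<alpha> = y\<beta>\<close> of \<open>D\<^sub>3\<close> both contain \<open>C\<close>. So the first surface meets each of the other
  two in a line, and the last two meet in \<open>C\<close> together with one more line. Two of the four curves
  meet only in the points \<open>[1 : 0]\<close> (which is on all of them except the last line) and \<open>[0 : 1]\<close>
  (which is on \<open>C\<close> and the last line) of \<open>C\<close>. There are therefore three surfaces, four curves and
  two points.

  On the tropical side the cells are cut out by linear inequalities in \<open>a\<close>, \<open>b\<close>, \<open>nc\<close> and
  \<open>min b (nc)\<close>. The plane \<open>Pi_L\<close> is \<open>a = min b (nc)\<close> and contains \<open>\<rho>\<^sub>2\<close> and \<open>\<rho>\<^sub>3\<close>; on the side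
  \<open>a \<ge> min b (nc)\<close> of it lie all three rays, on the other side only \<open>\<rho>\<^sub>2\<close> and \<open>\<rho>\<^sub>3\<close>. So the
  cells of the left-hand subdivision have the same incidences, in reverse, as the strata on \<open>X\<close>.

  The other extraction needs no second computation: exchanging \<open>x\<close> and \<open>z\<close> takes \<open>Y\<close> to itself,
  exchanges \<open>D\<^sub>1\<close> and \<open>D\<^sub>2\<close>, and takes \<open>X\<close> to \<open>X'\<close> (\<open>X'_eq_mirror\<close>). In the right-hand
  subdivision the wall \<open>a = b\<close> contains \<open>\<rho>\<^sub>1\<close> and \<open>\<rho>\<^sub>3\<close>, so that \<open>\<rho>\<^sub>1\<close> and \<open>\<rho>\<^sub>2\<close> have exchanged
  their roles as well. Hence a single abstract poset of nine faces describes both subdivisions and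
  both boundary complexes, and \<open>duality_of_labelling\<close> turns a labelling of cells and of strata by
  this poset into the required bijection.

  The algebraic geometry that enters, namely Zariski closures and irreducibility, is all reduced to
  \<open>poly_curve_in_closed\<close>: a Zariski closed set that contains infinitely many points of a polynomially
  parametrised curve contains the whole curve.\<close>

section \<open>The common face poset and the shape of the duality\<close>

text \<open>The nine faces. \<open>A\<close> stands for the divisor that meets the exceptional curve in a single point,
  \<open>B\<close> for the one among the strict transforms of \<open>D\<^sub>1\<close>, \<open>D\<^sub>2\<close> that contains it, and \<open>T\<close> for the
  strict transform of \<open>D\<^sub>3\<close>, the divisor over \<open>t = 0\<close>. On \<open>X\<close> these are the divisors with
  indices 1, 2, 3, and on \<open>X'\<close> those with indices 2, 1, 3. The names are those of the cells:
  \<open>Wall\<close> is the subdividing plane, dual to the exceptional curve, and the two chambers are named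
  after their rays.\<close>

datatype face = RayA | RayB | RayT | FaceAB | FaceAT | FaceBT | Wall | ChamberABT | ChamberBT

fun subfaces :: "face \<Rightarrow> face set" where
  "subfaces RayA = {RayA}"
| "subfaces RayB = {RayB}"
| "subfaces RayT = {RayT}"
| "subfaces FaceAB = {RayA, RayB, FaceAB}"
| "subfaces FaceAT = {RayA, RayT, FaceAT}"
| "subfaces FaceBT = {RayB, RayT, FaceBT}"
| "subfaces Wall = {RayB, RayT, Wall}"
| "subfaces ChamberABT = {RayA, RayB, RayT, FaceAB, FaceAT, Wall, ChamberABT}"
| "subfaces ChamberBT = {RayB, RayT, FaceBT, Wall, ChamberBT}"

fun cell_dim :: "face \<Rightarrow> nat" where
  "cell_dim RayA = 1" | "cell_dim RayB = 1" | "cell_dim RayT = 1"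
| "cell_dim FaceAB = 2" | "cell_dim FaceAT = 2" | "cell_dim FaceBT = 2" | "cell_dim Wall = 2"
| "cell_dim ChamberABT = 3" | "cell_dim ChamberBT = 3"

lemma UNIV_face: "UNIV = {RayA, RayB, RayT, FaceAB, FaceAT, FaceBT, Wall, ChamberABT, ChamberBT}"
  using face.exhaust by blast

lemma faces_of_dim:
  "{f. cell_dim f = 1} = {RayA, RayB, RayT}"
  "{f. cell_dim f = 2} = {FaceAB, FaceAT, FaceBT, Wall}"
  "{f. cell_dim f = 3} = {ChamberABT, ChamberBT}"
  by (auto elim: cell_dim.elims)

text \<open>The map \<open>cell f \<mapsto> S f\<close> is well defined and injective because equality of cells, and of strata, is
  mutual inclusion, and the inclusions on the two sides determine each other.\<close>

lemma duality_of_labelling: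
  fixes cell :: "face \<Rightarrow> trop set"
  assumes order: "\<And>f g. cell f \<subseteq> cell g \<longleftrightarrow> S g \<subseteq> S f"
    and dims: "\<And>f. trop_dim n (cell f) = cell_dim f"
    and strata: "\<And>k. k \<le> 2 \<Longrightarrow> strata I E k = S ` {f. cell_dim f = 3 - k}"
  shows "\<exists>\<phi>. duality n (range cell) I E \<phi> \<and> (\<forall>f. \<phi> (cell f) = S f)"
proof -
  let ?\<phi> = "\<lambda>c. S (inv cell c)"
  have eq: "S f = S g" if "cell f = cell g" for f g
    using order[of f g] order[of g f] that by auto
  have \<phi>: "?\<phi> (cell f) = S f" for f by (rule eq) (simp add: f_inv_into_f)
  have range: "range S = (\<Union>k\<le>2. strata I E k)"
  proof -
    have "\<exists>k\<le>2. cell_dim f = 3 - k" for f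
      by (rule exI[of _ "3 - cell_dim f"]) (cases f; simp)
    then have "range S \<subseteq> (\<Union>k\<le>2. S ` {f. cell_dim f = 3 - k})" by blast
    then show ?thesis by (auto simp: strata)
  qed
  have "bij_betw ?\<phi> (range cell) (\<Union>k\<le>2. strata I E k)"
  proof (rule bij_betwI')
    show "?\<phi> c = ?\<phi> c' \<longleftrightarrow> c = c'" if c: "c \<in> range cell" and c': "c' \<in> range cell" for c c'
    proof -
      obtain f where f: "c = cell f" using c by (rule rangeE)
      obtain g where g: "c' = cell g" using c' by (rule rangeE)
      show ?thesis unfolding f g \<phi> set_eq_subset order by (rule conj_commute)
    qed
    show "?\<phi> c \<in> (\<Union>k\<le>2. strata I E k)" if "c \<in> range cell" for c
      using that unfolding range[symmetric] by auto
    show "\<exists>c\<in>range cell. s = ?\<phi> c" if "s \<in> (\<Union>k\<le>2. strata I E k)" for s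
      using that unfolding range[symmetric] by (auto simp: \<phi>)
  qed
  moreover have "\<forall>c\<in>range cell. \<forall>c'\<in>range cell. c \<subseteq> c' \<longleftrightarrow> ?\<phi> c' \<subseteq> ?\<phi> c"
    by (auto simp: \<phi> order)
  moreover have "?\<phi> ` {c \<in> range cell. trop_dim n c = 3 - k} = strata I E k" if "k \<le> 2" for k
  proof -
    have "{c \<in> range cell. trop_dim n c = 3 - k} = cell ` {f. cell_dim f = 3 - k}"
      by (auto simp: dims)
    then show ?thesis by (simp add: strata[OF that] image_image \<phi>)
  qed
  ultimately show ?thesis using \<phi> unfolding duality_def by (intro exI[of _ ?\<phi>]) blast
qed

section \<open>Points of the projective line and loci in \<open>A\<^sup>4 \<times> P\<^sup>1\<close>\<close>

lemma hom_pt_scale: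
  assumes "c \<noteq> 0" "(\<alpha>, \<beta>) \<noteq> (0, 0)"
  shows "hom_pt (c * \<alpha>) (c * \<beta>) = hom_pt \<alpha> \<beta>"
  unfolding hom_pt_def
  by (rule Quotient3_rel_abs[OF Quotient3_proj1, symmetric]) (use assms in \<open>auto simp: proj1_rel_def\<close>)

lemma hom_pt_eqD:
  assumes "hom_pt \<alpha> \<beta> = hom_pt \<gamma> \<delta>" "(\<alpha>, \<beta>) \<noteq> (0, 0)" "(\<gamma>, \<delta>) \<noteq> (0, 0)"
  shows "\<exists>c. c \<noteq> 0 \<and> \<gamma> = c * \<alpha> \<and> \<delta> = c * \<beta>"
proof -
  have refl: "proj1_rel u u" if "u \<noteq> (0, 0)" for u
    using that by (auto simp: proj1_rel_def intro!: exI[of _ 1])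
  have "proj1_rel (\<alpha>, \<beta>) (\<gamma>, \<delta>)"
    using assms refl Quotient3_rel[OF Quotient3_proj1, of "(\<alpha>, \<beta>)" "(\<gamma>, \<delta>)"]
    by (auto simp: hom_pt_def)
  then show ?thesis by (auto simp: proj1_rel_def)
qed

text \<open>Each point of the projective line has exactly one of the normal forms \<open>[1 : \<beta>]\<close> and \<open>[0 : 1]\<close>.
  With them, statements about the quotient become statements about complex numbers.\<close>

lemma hom_pt_normal_eq_iff:
  "hom_pt 1 \<beta> = hom_pt 1 \<delta> \<longleftrightarrow> \<beta> = \<delta>" "hom_pt 0 1 \<noteq> hom_pt 1 \<beta>" "hom_pt 1 \<beta> \<noteq> hom_pt 0 1"
  using hom_pt_eqD[of 1 \<beta> 1 \<delta>] hom_pt_eqD[of 0 1 1 \<beta>] hom_pt_eqD[of 1 \<beta> 0 1] by auto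

lemma proj1_cases:
  obtains (finite) \<beta> where "q = hom_pt 1 \<beta>" | (infinite) "q = hom_pt 0 1"
proof -
  obtain \<alpha> \<beta> where q: "q = hom_pt \<alpha> \<beta>" and "proj1_rel (\<alpha>, \<beta>) (\<alpha>, \<beta>)"
    using Quotient3_abs_rep[OF Quotient3_proj1, of q] Quotient3_rep_reflp[OF Quotient3_proj1, of q]
    by (metis hom_pt_def surj_pair)
  then have nz: "(\<alpha>, \<beta>) \<noteq> (0, 0)" by (auto simp: proj1_rel_def)
  show ?thesis
  proof (cases "\<alpha> = 0")
    case True
    then have "hom_pt 0 1 = q" using nz hom_pt_scale[of \<beta> 0 1] q by auto
    then show ?thesis using that by simp
  next
    case False
    then have "hom_pt 1 (\<beta> / \<alpha>) = q" using nz hom_pt_scale[of \<alpha> 1 "\<beta> / \<alpha>"] q by auto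
    then show ?thesis using that by metis
  qed
qed

lemma aff4_proj1_cases:
  obtains x y z t \<alpha> \<beta> where "w = ((x, y, z, t), hom_pt \<alpha> \<beta>)" "(\<alpha>, \<beta>) \<noteq> (0, 0)"
proof -
  obtain x y z t q where w: "w = ((x, y, z, t), q)" by (metis surj_pair)
  show ?thesis
    by (rule proj1_cases[of q]) (use that w in auto)
qed

lemma aff4_proj1_normal_cases:
  obtains x y z t \<beta> where "w = ((x, y, z, t), hom_pt 1 \<beta>)" | x y z t where "w = ((x, y, z, t), hom_pt 0 1)"
  by (metis proj1_cases surj_pair)

text \<open>Conditions on \<open>x\<close>, \<open>y\<close>, \<open>z\<close>, \<open>t\<close> and the homogeneous coordinates \<open>\<alpha>\<close>, \<open>\<beta>\<close>.\<close>

type_synonym equations = "complex \<Rightarrow> complex \<Rightarrow> complex \<Rightarrow> complex \<Rightarrow> complex \<Rightarrow> complex \<Rightarrow> bool"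

definition locus :: "equations \<Rightarrow> (aff4 \<times> proj1) set" where
  "locus R = {((x, y, z, t), hom_pt \<alpha> \<beta>) | x y z t \<alpha> \<beta>. (\<alpha>, \<beta>) \<noteq> (0, 0) \<and> R x y z t \<alpha> \<beta>}"

definition homogeneous :: "equations \<Rightarrow> bool" where
  "homogeneous R \<longleftrightarrow> (\<forall>x y z t \<alpha> \<beta> c. c \<noteq> 0 \<and> R x y z t \<alpha> \<beta> \<longrightarrow> R x y z t (c * \<alpha>) (c * \<beta>))"

lemma locus_iff:
  assumes "homogeneous R" "(\<alpha>, \<beta>) \<noteq> (0, 0)"
  shows "((x, y, z, t), hom_pt \<alpha> \<beta>) \<in> locus R \<longleftrightarrow> R x y z t \<alpha> \<beta>"
proof
  assume "((x, y, z, t), hom_pt \<alpha> \<beta>) \<in> locus R"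
  then obtain \<gamma> \<delta> where "hom_pt \<alpha> \<beta> = hom_pt \<gamma> \<delta>" "(\<gamma>, \<delta>) \<noteq> (0, 0)" and R: "R x y z t \<gamma> \<delta>"
    by (auto simp: locus_def)
  with assms(2) obtain c where "c \<noteq> 0" "\<alpha> = c * \<gamma>" "\<beta> = c * \<delta>"
    using hom_pt_eqD[of \<gamma> \<delta> \<alpha> \<beta>] by auto
  with assms(1) R show "R x y z t \<alpha> \<beta>" by (simp add: homogeneous_def)
qed (use assms in \<open>auto simp: locus_def\<close>)

lemma form_zeros_iff:
  assumes "(\<alpha>, \<beta>) \<noteq> (0, 0)"
  shows "(p, hom_pt \<alpha> \<beta>) \<in> form_zeros d g \<longleftrightarrow> (\<Sum>i\<le>d. g i p * \<alpha> ^ i * \<beta> ^ (d - i)) = 0"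
    (is "?L \<longleftrightarrow> ?R")
proof
  assume ?L
  then obtain \<gamma> \<delta> where "hom_pt \<alpha> \<beta> = hom_pt \<gamma> \<delta>" "(\<gamma>, \<delta>) \<noteq> (0, 0)"
    and 0: "(\<Sum>i\<le>d. g i p * \<gamma> ^ i * \<delta> ^ (d - i)) = 0"
    unfolding form_zeros_def by auto
  then obtain c where c: "c \<noteq> 0" "\<alpha> = c * \<gamma>" "\<beta> = c * \<delta>"
    using hom_pt_eqD[of \<gamma> \<delta> \<alpha> \<beta>] assms by auto
  have "(\<Sum>i\<le>d. g i p * \<alpha> ^ i * \<beta> ^ (d - i)) = (\<Sum>i\<le>d. c ^ d * (g i p * \<gamma> ^ i * \<delta> ^ (d - i)))"
  proof (rule sum.cong)
    fix i assume "i \<in> {..d}"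
    then have "c ^ d = c ^ i * c ^ (d - i)" by (simp flip: power_add)
    then show "g i p * \<alpha> ^ i * \<beta> ^ (d - i) = c ^ d * (g i p * \<gamma> ^ i * \<delta> ^ (d - i))"
      by (simp add: c power_mult_distrib)
  qed simp
  then show ?R using 0 by (simp flip: sum_distrib_left)
qed (use assms in \<open>unfold form_zeros_def, blast\<close>)

lemma zariski_closed_form_zeros:
  "(\<And>i. poly_fun (g i)) \<Longrightarrow> zariski_closed (form_zeros d g)"
  unfolding zariski_closed_def by (intro exI[of _ "{(d, g)}"]) auto

lemma zariski_closed_Int:
  assumes "zariski_closed A" "zariski_closed B" shows "zariski_closed (A \<inter> B)"
proof -
  obtain F G where "\<forall>(d, g) \<in> F. \<forall>i. poly_fun (g i)" "A = (\<Inter>(d, g) \<in> F. form_zeros d g)"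
    "\<forall>(d, g) \<in> G. \<forall>i. poly_fun (g i)" "B = (\<Inter>(d, g) \<in> G. form_zeros d g)"
    using assms unfolding zariski_closed_def by auto
  then show ?thesis unfolding zariski_closed_def
    by (intro exI[of _ "F \<union> G"]) auto
qed

lemma locus_conj:
  assumes "homogeneous R" "homogeneous S"
  shows "locus (\<lambda>x y z t \<alpha> \<beta>. R x y z t \<alpha> \<beta> \<and> S x y z t \<alpha> \<beta>) = locus R \<inter> locus S"
proof -
  have "homogeneous (\<lambda>x y z t \<alpha> \<beta>. R x y z t \<alpha> \<beta> \<and> S x y z t \<alpha> \<beta>)"
    using assms by (simp add: homogeneous_def)
  with assms show ?thesis
    by (intro set_eqI, rule_tac w = x in aff4_proj1_cases) (simp add: locus_iff)
qed

definition closed_condition :: "equations \<Rightarrow> bool" where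
  "closed_condition R \<longleftrightarrow> homogeneous R \<and> zariski_closed (locus R)"

lemma closed_condition_conj:
  "closed_condition R \<Longrightarrow> closed_condition S \<Longrightarrow> closed_condition (\<lambda>x y z t \<alpha> \<beta>. R x y z t \<alpha> \<beta> \<and> S x y z t \<alpha> \<beta>)"
  unfolding closed_condition_def by (simp add: locus_conj zariski_closed_Int) (simp add: homogeneous_def)

text \<open>The form of degree 1 with coefficients \<open>g\<close> of \<open>\<alpha>\<close> and \<open>-h\<close> of \<open>\<beta>\<close>; together with the forms of
  degree 0 and with conjunctions it produces all the loci below.\<close>

lemma closed_condition_linear:
  assumes "poly_fun g" "poly_fun h"
  shows "closed_condition (\<lambda>x y z t \<alpha> \<beta>. g (x, y, z, t) * \<alpha> = h (x, y, z, t) * \<beta>)" (is "closed_condition ?R")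
proof -
  let ?f = "\<lambda>i p. if i = 1 then g p else (-1) * h p"
  have hom: "homogeneous ?R" by (auto simp: homogeneous_def)
  have "locus ?R = form_zeros 1 ?f"
    by (auto simp: locus_def form_zeros_def algebra_simps)
  moreover have pf: "poly_fun (?f i)" for i
    using assms poly_fun.mult[OF poly_fun.const[of "-1"] assms(2)] by (cases "i = 1") simp_all
  ultimately have "zariski_closed (locus ?R)"
    using zariski_closed_form_zeros[of ?f 1, OF pf] by (simp only:)
  then show ?thesis using hom by (simp add: closed_condition_def)
qed

lemma closed_condition_eq_0:
  assumes "poly_fun g"
  shows "closed_condition (\<lambda>x y z t \<alpha> \<beta>. g (x, y, z, t) = 0)" (is "closed_condition ?R")
proof -
  have "locus ?R = form_zeros 0 (\<lambda>_. g)" by (auto simp: locus_def form_zeros_def)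
  then have "zariski_closed (locus ?R)"
    using assms zariski_closed_form_zeros by simp
  then show ?thesis by (auto simp: closed_condition_def homogeneous_def)
qed

section \<open>Polynomial curves in Zariski closed sets\<close>

definition poly_map :: "(complex \<Rightarrow> complex) \<Rightarrow> bool" where
  "poly_map f \<longleftrightarrow> (\<exists>q. f = poly q)"

lemma poly_map_intros [simp, intro]:
  "poly_map (\<lambda>_. c)" "poly_map (\<lambda>s. s)"
  "poly_map f \<Longrightarrow> poly_map g \<Longrightarrow> poly_map (\<lambda>s. f s + g s)"
  "poly_map f \<Longrightarrow> poly_map g \<Longrightarrow> poly_map (\<lambda>s. f s * g s)"
  "poly_map f \<Longrightarrow> poly_map (\<lambda>s. - f s)"
  "poly_map f \<Longrightarrow> poly_map (\<lambda>s. f s ^ k)"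
proof -
  show "poly_map (\<lambda>_. c)" unfolding poly_map_def by (rule exI[of _ "[:c:]"]) auto
  show "poly_map (\<lambda>s. s)" unfolding poly_map_def by (rule exI[of _ "[:0, 1:]"]) auto
  assume "poly_map f"
  then obtain p where f: "f = poly p" by (auto simp: poly_map_def)
  show "poly_map (\<lambda>s. - f s)" unfolding poly_map_def by (rule exI[of _ "- p"]) (auto simp: f)
  show "poly_map (\<lambda>s. f s ^ k)" unfolding poly_map_def by (rule exI[of _ "p ^ k"]) (auto simp: f)
  assume "poly_map g"
  then obtain q where g: "g = poly q" by (auto simp: poly_map_def)
  show "poly_map (\<lambda>s. f s + g s)" unfolding poly_map_def by (rule exI[of _ "p + q"]) (auto simp: f g)
  show "poly_map (\<lambda>s. f s * g s)" unfolding poly_map_def by (rule exI[of _ "p * q"]) (auto simp: f g)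
qed

lemma poly_map_sum:
  "(\<And>i. i \<in> I \<Longrightarrow> poly_map (f i)) \<Longrightarrow> poly_map (\<lambda>s. \<Sum>i\<in>I. f i s)"
  by (induction I rule: infinite_finite_induct) auto

lemma poly_map_comp:
  assumes "poly_fun g" "poly_map x" "poly_map y" "poly_map z" "poly_map t"
  shows "poly_map (\<lambda>s. g (x s, y s, z s, t s))"
  using assms(1) by induction (use assms(2-) in auto)

definition poly_curve :: "(complex \<Rightarrow> aff4 \<times> proj1) \<Rightarrow> bool" where
  "poly_curve \<gamma> \<longleftrightarrow> (\<exists>x y z t \<alpha> \<beta>. poly_map x \<and> poly_map y \<and> poly_map z \<and> poly_map t \<and>
     poly_map \<alpha> \<and> poly_map \<beta> \<and> (\<forall>s. (\<alpha> s, \<beta> s) \<noteq> (0, 0)) \<and>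
     \<gamma> = (\<lambda>s. ((x s, y s, z s, t s), hom_pt (\<alpha> s) (\<beta> s))))"

lemma poly_curveI:
  "poly_map x \<Longrightarrow> poly_map y \<Longrightarrow> poly_map z \<Longrightarrow> poly_map t \<Longrightarrow> poly_map \<alpha> \<Longrightarrow> poly_map \<beta> \<Longrightarrow>
   (\<And>s. (\<alpha> s, \<beta> s) \<noteq> (0, 0)) \<Longrightarrow> poly_curve (\<lambda>s. ((x s, y s, z s, t s), hom_pt (\<alpha> s) (\<beta> s)))"
  unfolding poly_curve_def by blast

text \<open>Along the curve every defining form of \<open>A\<close> becomes a polynomial in the parameter, which vanishes
  identically as soon as it has infinitely many zeros. It is well defined to ask for the vanishing of
  a form at the chosen homogeneous coordinates, since they are never both zero.\<close>

lemma poly_curve_in_closed: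
  assumes "poly_curve \<gamma>" "zariski_closed A" "infinite {s. \<gamma> s \<in> A}"
  shows "range \<gamma> \<subseteq> A"
proof -
  obtain x y z t \<alpha> \<beta> where poly: "poly_map x" "poly_map y" "poly_map z" "poly_map t"
    "poly_map \<alpha>" "poly_map \<beta>" and nz: "\<And>s. (\<alpha> s, \<beta> s) \<noteq> (0, 0)"
    and \<gamma>: "\<gamma> = (\<lambda>s. ((x s, y s, z s, t s), hom_pt (\<alpha> s) (\<beta> s)))"
    using assms(1) unfolding poly_curve_def by (elim exE conjE) (rule that; simp)
  obtain F where F: "\<forall>(d, g) \<in> F. \<forall>i. poly_fun (g i)" "A = (\<Inter>(d, g) \<in> F. form_zeros d g)"
    using assms(2) unfolding zariski_closed_def by blast
  have "\<gamma> s \<in> form_zeros d g" if "(d, g) \<in> F" for d g s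
  proof -
    let ?f = "\<lambda>s. \<Sum>i\<le>d. g i (x s, y s, z s, t s) * \<alpha> s ^ i * \<beta> s ^ (d - i)"
    have on: "\<gamma> s \<in> form_zeros d g \<longleftrightarrow> ?f s = 0" for s
      by (simp only: \<gamma> form_zeros_iff[OF nz])
    have "poly_fun (g i)" for i using F(1) that by auto
    then have "poly_map (\<lambda>s. g i (x s, y s, z s, t s))" for i
      using poly(1-4) by (rule poly_map_comp)
    then have "poly_map (\<lambda>s. g i (x s, y s, z s, t s) * \<alpha> s ^ i * \<beta> s ^ (d - i))" for i
      by (intro poly_map_intros(4) poly_map_intros(6)[OF poly(5)] poly_map_intros(6)[OF poly(6)])
    then have "poly_map ?f" by (rule poly_map_sum)
    then obtain q where q: "?f = poly q" by (auto simp: poly_map_def)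
    have "{s. \<gamma> s \<in> A} \<subseteq> {s. poly q s = 0}"
    proof (intro Collect_mono impI)
      fix s assume "\<gamma> s \<in> A"
      then have "\<gamma> s \<in> form_zeros d g" using F(2) that by auto
      then show "poly q s = 0" using fun_cong[OF q, of s] by (simp only: on)
    qed
    then have "q = 0" using assms(3) poly_roots_finite finite_subset by blast
    then have "?f s = 0" using fun_cong[OF q, of s] by simp
    then show ?thesis by (simp only: on)
  qed
  then show ?thesis using F(2) by auto
qed

text \<open>This is how points over \<open>P\<close> are seen to lie in a closure: each is the value at 0 of a curve
  that is otherwise in the given set.\<close>

lemma poly_curve_limit:
  assumes "zariski_closed A" "poly_curve \<gamma>" "\<And>s. s \<noteq> 0 \<Longrightarrow> \<gamma> s \<in> A"
  shows "\<gamma> 0 \<in> A"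
proof -
  have "infinite (UNIV - {0 :: complex})"
    using infinite_UNIV_char_0 by (metis finite.emptyI finite_insert infinite_remove)
  then have "infinite {s. \<gamma> s \<in> A}"
    by (rule infinite_super[rotated]) (use assms(3) in auto)
  then show ?thesis using poly_curve_in_closed assms by blast
qed

text \<open>If \<open>T\<close> is covered by two closed sets, then one of them contains infinitely many points of the
  curve, hence the curve, hence \<open>T\<close>. It is enough that the curve is dense in \<open>T\<close>, as the affine line is
  in the projective line.\<close>

lemma irreducible_setI:
  assumes "poly_curve \<gamma>" "range \<gamma> \<subseteq> T" "\<And>A. zariski_closed A \<Longrightarrow> range \<gamma> \<subseteq> A \<Longrightarrow> T \<subseteq> A"
  shows "irreducible_set T"
  unfolding irreducible_set_def
proof (intro conjI allI impI)
  show "T \<noteq> {}" using assms(2) by auto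
next
  fix A B assume AB: "zariski_closed A \<and> zariski_closed B \<and> T \<subseteq> A \<union> B"
  have "{s. \<gamma> s \<in> A} \<union> {s. \<gamma> s \<in> B} = UNIV" using AB assms(2) by auto
  then have "infinite {s. \<gamma> s \<in> A} \<or> infinite {s. \<gamma> s \<in> B}"
    using infinite_UNIV_char_0[where 'a = complex] finite_Un by metis
  then show "T \<subseteq> A \<or> T \<subseteq> B"
    using AB assms(1,3) poly_curve_in_closed by blast
qed

lemma irreducible_range: "poly_curve \<gamma> \<Longrightarrow> irreducible_set (range \<gamma>)"
  by (erule irreducible_setI) auto

lemma irreducible_components_irreducible:
  "irreducible_set S \<Longrightarrow> irreducible_components S = {S}"
  unfolding irreducible_components_def by auto

lemma irreducible_components_Un:
  assumes "irreducible_set S" "irreducible_set T" "zariski_closed S" "zariski_closed T"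
    "\<not> S \<subseteq> T" "\<not> T \<subseteq> S"
  shows "irreducible_components (S \<union> T) = {S, T}"
proof -
  \<comment> \<open>Closedness of \<open>S\<close> and \<open>T\<close> enters here, through the definition of irreducibility.\<close>
  have *: "Z \<subseteq> S \<or> Z \<subseteq> T" if "irreducible_set Z" "Z \<subseteq> S \<union> T" for Z
    using that assms(3,4) unfolding irreducible_set_def by blast
  have "Z = S" if "irreducible_set Z" "S \<subseteq> Z" "Z \<subseteq> S \<union> T" for Z
    using that assms(5) * by blast
  moreover have "Z = T" if "irreducible_set Z" "T \<subseteq> Z" "Z \<subseteq> S \<union> T" for Z
    using that assms(6) * by blast
  moreover have "Z = S \<or> Z = T"
    if "irreducible_set Z" "Z \<subseteq> S \<union> T"
      "\<And>Z'. Z \<subseteq> Z' \<Longrightarrow> Z' \<subseteq> S \<union> T \<Longrightarrow> irreducible_set Z' \<Longrightarrow> Z' = Z" for Z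
    using *[OF that(1,2)] that(3)[of S] that(3)[of T] assms(1,2) by auto
  ultimately have "T' \<in> irreducible_components (S \<union> T) \<longleftrightarrow> T' = S \<or> T' = T" for T'
    using assms(1,2) unfolding irreducible_components_def mem_Collect_eq
    by (metis Un_upper1 Un_upper2)
  then show ?thesis by blast
qed

section \<open>The strata on the first extraction\<close>

text \<open>The equations of the strata on \<open>X\<close>. Here \<open>A\<close>, \<open>B\<close>, \<open>T\<close> are the strict transforms of \<open>D\<^sub>1\<close>, \<open>D\<^sub>2\<close>,
  \<open>D\<^sub>3\<close>, the faces of dimension 2 stand for curves and the chambers for points.\<close>

fun eqns :: "nat \<Rightarrow> face \<Rightarrow> equations" where
  "eqns n RayA = (\<lambda>x y z t \<alpha> \<beta>. x = 0 \<and> y = 0 \<and> \<beta> = 0)"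
| "eqns n RayB = (\<lambda>x y z t \<alpha> \<beta>. y = 0 \<and> z = 0 \<and> x * \<alpha> = t ^ n * \<beta>)"
| "eqns n RayT = (\<lambda>x y z t \<alpha> \<beta>. t = 0 \<and> y * \<alpha> = z * \<beta> \<and> x * \<alpha> = y * \<beta>)"
| "eqns n FaceAB = (\<lambda>x y z t \<alpha> \<beta>. x = 0 \<and> y = 0 \<and> z = 0 \<and> \<beta> = 0)"
| "eqns n FaceAT = (\<lambda>x y z t \<alpha> \<beta>. x = 0 \<and> y = 0 \<and> t = 0 \<and> \<beta> = 0)"
| "eqns n FaceBT = (\<lambda>x y z t \<alpha> \<beta>. y = 0 \<and> z = 0 \<and> t = 0 \<and> \<alpha> = 0)"
| "eqns n Wall = (\<lambda>x y z t \<alpha> \<beta>. x = 0 \<and> y = 0 \<and> z = 0 \<and> t = 0)"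
| "eqns n ChamberABT = (\<lambda>x y z t \<alpha> \<beta>. x = 0 \<and> y = 0 \<and> z = 0 \<and> t = 0 \<and> \<beta> = 0)"
| "eqns n ChamberBT = (\<lambda>x y z t \<alpha> \<beta>. x = 0 \<and> y = 0 \<and> z = 0 \<and> t = 0 \<and> \<alpha> = 0)"

definition stratum :: "nat \<Rightarrow> face \<Rightarrow> (aff4 \<times> proj1) set" where
  "stratum n f = locus (eqns n f)"

lemma poly_fun_power: "poly_fun g \<Longrightarrow> poly_fun (\<lambda>p. g p ^ k)"
  by (induction k) (auto intro: poly_fun.intros)

lemma closed_condition_basic:
  "closed_condition (\<lambda>x y z t \<alpha> \<beta>. x = 0)"
  "closed_condition (\<lambda>x y z t \<alpha> \<beta>. y = 0)"
  "closed_condition (\<lambda>x y z t \<alpha> \<beta>. z = 0)"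
  "closed_condition (\<lambda>x y z t \<alpha> \<beta>. t = 0)"
  "closed_condition (\<lambda>x y z t \<alpha> \<beta>. \<alpha> = 0)"
  "closed_condition (\<lambda>x y z t \<alpha> \<beta>. \<beta> = 0)"
  "closed_condition (\<lambda>x y z t \<alpha> \<beta>. x * \<alpha> = y * \<beta>)"
  "closed_condition (\<lambda>x y z t \<alpha> \<beta>. y * \<alpha> = x * \<beta>)"
  "closed_condition (\<lambda>x y z t \<alpha> \<beta>. y * \<alpha> = z * \<beta>)"
  "closed_condition (\<lambda>x y z t \<alpha> \<beta>. x * \<alpha> = t ^ n * \<beta>)"
  "closed_condition (\<lambda>x y z t \<alpha> \<beta>. z * \<alpha> = (y + t ^ n) * \<beta>)"
  using closed_condition_eq_0[OF poly_fun.coord_x] closed_condition_eq_0[OF poly_fun.coord_y]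
    closed_condition_eq_0[OF poly_fun.coord_z] closed_condition_eq_0[OF poly_fun.coord_t]
    closed_condition_linear[OF poly_fun.const[of 1] poly_fun.const[of 0]]
    closed_condition_linear[OF poly_fun.const[of 0] poly_fun.const[of 1]]
    closed_condition_linear[OF poly_fun.coord_x poly_fun.coord_y]
    closed_condition_linear[OF poly_fun.coord_y poly_fun.coord_x]
    closed_condition_linear[OF poly_fun.coord_y poly_fun.coord_z]
    closed_condition_linear[OF poly_fun.coord_x poly_fun_power[OF poly_fun.coord_t]]
    closed_condition_linear[OF poly_fun.coord_z poly_fun.add[OF poly_fun.coord_y poly_fun_power[OF poly_fun.coord_t]]]
  by (simp_all add: eq_commute[of "0 :: complex"])

lemma closed_condition_eqns: "closed_condition (eqns n f)"
  by (cases f; simp only: eqns.simps; intro closed_condition_conj closed_condition_basic)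

lemma stratum_iff:
  "(\<alpha>, \<beta>) \<noteq> (0, 0) \<Longrightarrow> ((x, y, z, t), hom_pt \<alpha> \<beta>) \<in> stratum n f \<longleftrightarrow> eqns n f x y z t \<alpha> \<beta>"
  using closed_condition_eqns[of n f] locus_iff unfolding closed_condition_def stratum_def by blast

lemma zariski_closed_stratum: "zariski_closed (stratum n f)"
  using closed_condition_eqns[of n f] unfolding closed_condition_def stratum_def by blast

lemma eqns_mono:
  "n \<ge> 1 \<Longrightarrow> f \<in> subfaces g \<Longrightarrow> eqns n g x y z t \<alpha> \<beta> \<Longrightarrow> eqns n f x y z t \<alpha> \<beta>"
  by (cases g) auto

text \<open>A point of each stratum that lies only on those strata which contain the whole of that stratum. With
  such points, inclusion of strata is decided by the equations at a single point.\<close>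

fun witness :: "face \<Rightarrow> aff4 \<times> complex \<times> complex" where
  "witness RayA = ((0, 0, 1, 1), 1, 0)"
| "witness RayB = ((1, 0, 0, 1), 1, 1)"
| "witness RayT = ((1, 1, 1, 0), 1, 1)"
| "witness FaceAB = ((0, 0, 0, 1), 1, 0)"
| "witness FaceAT = ((0, 0, 1, 0), 1, 0)"
| "witness FaceBT = ((1, 0, 0, 0), 0, 1)"
| "witness Wall = ((0, 0, 0, 0), 1, 1)"
| "witness ChamberABT = ((0, 0, 0, 0), 1, 0)"
| "witness ChamberBT = ((0, 0, 0, 0), 0, 1)"

lemma witness_eqns:
  assumes "n \<ge> 1" "witness g = ((x, y, z, t), \<alpha>, \<beta>)"
  shows "(\<alpha>, \<beta>) \<noteq> (0, 0)" "eqns n f x y z t \<alpha> \<beta> \<longleftrightarrow> f \<in> subfaces g"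
proof -
  show "(\<alpha>, \<beta>) \<noteq> (0, 0)" using assms by (cases g) auto
  show "eqns n f x y z t \<alpha> \<beta> \<longleftrightarrow> f \<in> subfaces g"
    using assms by (cases g; cases f) auto
qed

lemma stratum_subset_iff:
  assumes "n \<ge> 1"
  shows "stratum n g \<subseteq> stratum n f \<longleftrightarrow> f \<in> subfaces g"
proof
  assume sub: "stratum n g \<subseteq> stratum n f"
  obtain x y z t \<alpha> \<beta> where w: "witness g = ((x, y, z, t), \<alpha>, \<beta>)" by (metis surj_pair)
  have "g \<in> subfaces g" by (cases g) auto
  then show "f \<in> subfaces g"
    using sub witness_eqns(2)[OF assms w] stratum_iff[OF witness_eqns(1)[OF assms w]]
    by (metis subsetD)
next
  assume "f \<in> subfaces g"
  then show "stratum n g \<subseteq> stratum n f"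
    unfolding stratum_def locus_def using eqns_mono[OF assms] by blast
qed

lemma stratum_eq_iff: "n \<ge> 1 \<Longrightarrow> stratum n f = stratum n g \<longleftrightarrow> f = g"
  unfolding set_eq_subset by (cases f; cases g; simp add: stratum_subset_iff)

text \<open>The three lines are parametrised by their affine coordinate. The exceptional curve is the closure of
  its points \<open>[1 : s]\<close>.\<close>

lemma irreducible_curve_strata:
  "irreducible_set (stratum n FaceAB)" "irreducible_set (stratum n FaceAT)"
  "irreducible_set (stratum n FaceBT)" "irreducible_set (stratum n Wall)"
proof -
  let ?AB = "\<lambda>s. ((0, 0, 0, s), hom_pt 1 0)" and ?AT = "\<lambda>s. ((0, 0, s, 0), hom_pt 1 0)"
    and ?BT = "\<lambda>s. ((s, 0, 0, 0), hom_pt 0 1)" and ?C = "\<lambda>s. ((0, 0, 0, 0), hom_pt 1 s)"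
  have c: "poly_curve ?AB" "poly_curve ?AT" "poly_curve ?BT" "poly_curve ?C"
    by (rule poly_curveI; auto)+
  have r: "range ?AB = stratum n FaceAB" "range ?AT = stratum n FaceAT" "range ?BT = stratum n FaceBT"
    by (intro set_eqI, rule_tac w = x in aff4_proj1_normal_cases;
        auto simp: stratum_iff hom_pt_normal_eq_iff)+
  show "irreducible_set (stratum n FaceAB)" "irreducible_set (stratum n FaceAT)"
    "irreducible_set (stratum n FaceBT)"
    unfolding r[symmetric] by (intro irreducible_range c)+
  show "irreducible_set (stratum n Wall)"
  proof (rule irreducible_setI[OF c(4)])
    show "range ?C \<subseteq> stratum n Wall" by (auto simp: stratum_iff)
    fix A assume A: "zariski_closed A" "range ?C \<subseteq> A"
    \<comment> \<open>The remaining point \<open>[0 : 1]\<close> is the limit of \<open>[s : 1] = [1 : 1/s]\<close>.\<close>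
    have "((0, 0, 0, 0), hom_pt s 1) \<in> A" if "s \<noteq> 0" for s
      using A(2) hom_pt_scale[of s 1 "inverse s"] that by auto
    then have inf: "((0, 0, 0, 0), hom_pt 0 1) \<in> A"
      using A(1) by (intro poly_curve_limit[where \<gamma> = "\<lambda>s. ((0, 0, 0, 0), hom_pt s 1)"] poly_curveI) auto
    show "stratum n Wall \<subseteq> A"
    proof
      fix w assume "w \<in> stratum n Wall"
      then obtain q where "w = ((0, 0, 0, 0), q)" by (auto simp: stratum_def locus_def)
      then show "w \<in> A" using inf A(2) by (cases q rule: proj1_cases) auto
    qed
  qed
qed

text \<open>On \<open>B \<inter> T\<close> the equations reduce to \<open>y = z = t = 0\<close> and \<open>x\<alpha> = 0\<close>, whence two components. This
  uses \<open>n \<ge> 1\<close>: the term \<open>t\<^sup>n\<beta>\<close> has to vanish with \<open>t\<close>.\<close>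

lemma stratum_Int:
  assumes "n \<ge> 1"
  shows "stratum n RayA \<inter> stratum n RayB = stratum n FaceAB"
    "stratum n RayA \<inter> stratum n RayT = stratum n FaceAT"
    "stratum n RayB \<inter> stratum n RayT = stratum n FaceBT \<union> stratum n Wall"
  using assms
  by (intro set_eqI; rule_tac w = x in aff4_proj1_cases; auto simp: stratum_iff)+

lemma point_strata:
  "stratum n ChamberABT = {(P, hom_pt 1 0)}" "stratum n ChamberBT = {(P, hom_pt 0 1)}"
  by (intro set_eqI, rule_tac w = x in aff4_proj1_normal_cases;
      auto simp: stratum_iff hom_pt_normal_eq_iff P_def)+

lemma curve_strata_triple:
  "curve_strata {1, 2, 3} E = irreducible_components (E 1 \<inter> E 2) \<union>
     irreducible_components (E 1 \<inter> E 3) \<union> irreducible_components (E 2 \<inter> E 3)"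
proof -
  have "{1, 2, 3} - {1} = {2, 3 :: nat}" "{1, 2, 3} - {2} = {1, 3 :: nat}" "{1, 2, 3} - {3} = {1, 2 :: nat}"
    by auto
  then show ?thesis unfolding curve_strata_def
    by (simp add: Int_commute[of "E 2" "E 1"] Int_commute[of "E 3"] Int_commute[of "E 2" "E (Suc 0)"] Un_ac)
qed

text \<open>The indices \<open>i\<close> and \<open>j\<close> of \<open>A\<close> and \<open>B\<close> are kept variable because the other extraction has them
  in the opposite order.\<close>

lemma strata_stratum:
  assumes n: "n \<ge> 1" and E: "E i = stratum n RayA" "E j = stratum n RayB" "E 3 = stratum n RayT"
    and ij: "{i, j} = {1, 2}" and k: "k \<le> 2"
  shows "strata {1, 2, 3} E k = stratum n ` {f. cell_dim f = 3 - k}"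
proof -
  have ij: "i = 1 \<and> j = 2 \<or> i = 2 \<and> j = 1" using ij by (auto simp: doubleton_eq_iff)
  have "\<not> stratum n FaceBT \<subseteq> stratum n Wall" "\<not> stratum n Wall \<subseteq> stratum n FaceBT"
    by (simp_all add: stratum_subset_iff[OF n])
  then have comps: "irreducible_components (stratum n FaceBT \<union> stratum n Wall) = {stratum n FaceBT, stratum n Wall}"
    by (intro irreducible_components_Un irreducible_curve_strata zariski_closed_stratum)
  have curves: "curve_strata {1, 2, 3} E = stratum n ` {FaceAB, FaceAT, FaceBT, Wall}"
    using ij
  proof
    assume "i = 1 \<and> j = 2"
    then have "E 1 = stratum n RayA" "E 2 = stratum n RayB" using E by auto
    then show ?thesis unfolding curve_strata_triple E(3)
      by (simp add: stratum_Int[OF n] comps irreducible_components_irreducible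
          irreducible_curve_strata insert_commute)
  next
    assume "i = 2 \<and> j = 1"
    then have "E 2 = stratum n RayA" "E 1 = stratum n RayB" using E by auto
    then show ?thesis unfolding curve_strata_triple E(3)
      using stratum_Int(1)[OF n]
      by (simp add: Int_commute[of "stratum n RayB" "stratum n RayA"] stratum_Int[OF n] comps
          irreducible_components_irreducible irreducible_curve_strata insert_commute)
  qed
  have points: "strata {1, 2, 3} E 0 = stratum n ` {ChamberABT, ChamberBT}"
  proof -
    \<comment> \<open>Two of the four curves meet at most in the two points.\<close>
    have meet: "w \<in> stratum n ChamberABT \<or> w \<in> stratum n ChamberBT"
      if "f \<in> {FaceAB, FaceAT, FaceBT, Wall}" "g \<in> {FaceAB, FaceAT, FaceBT, Wall}" "f \<noteq> g"
        "w \<in> stratum n f" "w \<in> stratum n g" for f g w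
    proof -
      obtain x y z t \<alpha> \<beta> where w: "w = ((x, y, z, t), hom_pt \<alpha> \<beta>)" "(\<alpha>, \<beta>) \<noteq> (0, 0)"
        using aff4_proj1_cases by blast
      then have "eqns n f x y z t \<alpha> \<beta>" "eqns n g x y z t \<alpha> \<beta>"
        using that(4,5) by (simp_all add: stratum_iff[OF w(2)])
      then have "eqns n ChamberABT x y z t \<alpha> \<beta> \<or> eqns n ChamberBT x y z t \<alpha> \<beta>"
        using that(1-3) w(2) by (elim insertE emptyE; simp)
      then show ?thesis by (simp only: w(1) stratum_iff[OF w(2)])
    qed
    \<comment> \<open>Conversely each of the points lies on two different curves.\<close>
    have inc: "stratum n ChamberABT \<subseteq> stratum n FaceAB" "stratum n ChamberABT \<subseteq> stratum n FaceAT"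
      "stratum n ChamberBT \<subseteq> stratum n FaceBT" "stratum n ChamberBT \<subseteq> stratum n Wall"
      "stratum n FaceAB \<noteq> stratum n FaceAT" "stratum n FaceBT \<noteq> stratum n Wall"
      by (simp_all add: stratum_subset_iff[OF n] stratum_eq_iff[OF n])
    have meets: "w \<in> stratum n ChamberABT \<or> w \<in> stratum n ChamberBT \<longleftrightarrow>
        (\<exists>S\<in>curve_strata {1, 2, 3} E. \<exists>T\<in>curve_strata {1, 2, 3} E. S \<noteq> T \<and> w \<in> S \<and> w \<in> T)"
      (is "_ \<longleftrightarrow> ?meet w") for w
    proof
      assume "w \<in> stratum n ChamberABT \<or> w \<in> stratum n ChamberBT"
      then show "?meet w"
      proof
        assume "w \<in> stratum n ChamberABT"
        then show ?thesis unfolding curves using inc(1,2,5)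
          by (intro bexI[of _ "stratum n FaceAB"] bexI[of _ "stratum n FaceAT"]) auto
      next
        assume "w \<in> stratum n ChamberBT"
        then show ?thesis unfolding curves using inc(3,4,6)
          by (intro bexI[of _ "stratum n FaceBT"] bexI[of _ "stratum n Wall"]) auto
      qed
    next
      assume "?meet w"
      then obtain S T where ST: "S \<in> stratum n ` {FaceAB, FaceAT, FaceBT, Wall}"
        "T \<in> stratum n ` {FaceAB, FaceAT, FaceBT, Wall}" "S \<noteq> T" "w \<in> S" "w \<in> T"
        unfolding curves by (elim bexE conjE) (rule that)
      obtain f where f: "S = stratum n f" "f \<in> {FaceAB, FaceAT, FaceBT, Wall}"
        using ST(1) by (rule imageE)
      obtain g where g: "T = stratum n g" "g \<in> {FaceAB, FaceAT, FaceBT, Wall}"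
        using ST(2) by (rule imageE)
      have "f \<noteq> g" using ST(3) f(1) g(1) by auto
      then show "w \<in> stratum n ChamberABT \<or> w \<in> stratum n ChamberBT"
        using meet[OF f(2) g(2)] ST(4,5) f(1) g(1) by simp
    qed
    have "strata {1, 2, 3} E 0 = {{w} | w. w \<in> stratum n ChamberABT \<or> w \<in> stratum n ChamberBT}"
      unfolding strata_def meets by simp
    also have "\<dots> = (\<lambda>w. {w}) ` (stratum n ChamberABT \<union> stratum n ChamberBT)" by auto
    finally show ?thesis by (auto simp: point_strata)
  qed
  have divisors: "strata {1, 2, 3} E 2 = stratum n ` {RayA, RayB, RayT}"
    using ij E by (auto simp: strata_def)
  have lines: "strata {1, 2, 3} E 1 = stratum n ` {FaceAB, FaceAT, FaceBT, Wall}"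
    unfolding curves[symmetric] by (simp add: strata_def)
  consider "k = 0" | "k = 1" | "k = 2" using k by linarith
  then show ?thesis
    by cases (simp_all add: points[simplified] lines[simplified] divisors[simplified] faces_of_dim[simplified])
qed

section \<open>Strict transforms of the boundary divisors\<close>

text \<open>The criterion for recognising a strict transform \<open>S\<close>: a closed set with the right points off the
  fibre over \<open>P\<close>, each of whose points over \<open>P\<close> is approached along a curve in \<open>S\<close> that leaves
  that fibre.\<close>

lemma strict_transform_eqI:
  assumes "zariski_closed S" "\<And>w. w \<in> Z \<Longrightarrow> fst w \<in> E \<Longrightarrow> fst w \<noteq> P \<Longrightarrow> w \<in> S"
    "\<And>w. w \<in> S \<Longrightarrow> w \<in> Z \<and> fst w \<in> E"
    "\<And>w. w \<in> S \<Longrightarrow> fst w = P \<Longrightarrow>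
       \<exists>\<gamma>. poly_curve \<gamma> \<and> \<gamma> 0 = w \<and> (\<forall>s. s \<noteq> 0 \<longrightarrow> \<gamma> s \<in> S \<and> fst (\<gamma> s) \<noteq> P)"
  shows "strict_transform Z E = S"
  unfolding strict_transform_def
proof (rule hull_unique)
  show "{w \<in> Z. fst w \<in> E - {P}} \<subseteq> S" using assms(2) by auto
  show "zariski_closed S" by fact
  fix A assume A: "{w \<in> Z. fst w \<in> E - {P}} \<subseteq> A" "zariski_closed A"
  show "S \<subseteq> A"
  proof
    fix w assume w: "w \<in> S"
    show "w \<in> A"
    proof (cases "fst w = P")
      case True
      then obtain \<gamma> where \<gamma>: "poly_curve \<gamma>" "\<gamma> 0 = w" "\<And>s. s \<noteq> 0 \<Longrightarrow> \<gamma> s \<in> S \<and> fst (\<gamma> s) \<noteq> P"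
        using assms(4)[OF w] by auto
      then have "\<gamma> s \<in> A" if "s \<noteq> 0" for s using assms(3) that A(1) by blast
      then show ?thesis using poly_curve_limit[OF A(2) \<gamma>(1)] \<gamma>(2) by simp
    next
      case False
      then show ?thesis using A(1) assms(3)[OF w] by auto
    qed
  qed
qed

lemma homogeneous_X: "homogeneous (\<lambda>x y z t \<alpha> \<beta>. y * \<alpha> = z * \<beta> \<and> x * \<alpha> = (y + t ^ n) * \<beta>)"
  by (auto simp: homogeneous_def)

lemma X_iff:
  "(\<alpha>, \<beta>) \<noteq> (0, 0) \<Longrightarrow>
    ((x, y, z, t), hom_pt \<alpha> \<beta>) \<in> X n \<longleftrightarrow> y * \<alpha> = z * \<beta> \<and> x * \<alpha> = (y + t ^ n) * \<beta>"
  using locus_iff[OF homogeneous_X] unfolding locus_def X_def .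

lemma fibre_P_X: "n \<ge> 1 \<Longrightarrow> fibre_P (X n) = stratum n Wall"
  unfolding fibre_P_def
  by (intro set_eqI, rule_tac w = x in aff4_proj1_cases) (auto simp: X_iff stratum_iff P_def)

lemma strict_transform_D1:
  assumes "n \<ge> 1"
  shows "strict_transform (X n) (D n 1) = stratum n RayA"
proof (rule strict_transform_eqI)
  show "zariski_closed (stratum n RayA)" by (rule zariski_closed_stratum)
next
  fix w assume w: "w \<in> X n" "fst w \<in> D n 1" "fst w \<noteq> P"
  then show "w \<in> stratum n RayA"
    by (cases w rule: aff4_proj1_normal_cases) (auto simp: X_iff stratum_iff D_def P_def)
next
  fix w assume "w \<in> stratum n RayA"
  then show "w \<in> X n \<and> fst w \<in> D n 1"
    by (cases w rule: aff4_proj1_normal_cases) (auto simp: X_iff stratum_iff D_def Y_def)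
next
  fix w assume "w \<in> stratum n RayA" "fst w = P"
  then have "w = ((0, 0, 0, 0), hom_pt 1 0)"
    by (cases w rule: aff4_proj1_normal_cases) (auto simp: stratum_iff P_def)
  then show "\<exists>\<gamma>. poly_curve \<gamma> \<and> \<gamma> 0 = w \<and>
      (\<forall>s. s \<noteq> 0 \<longrightarrow> \<gamma> s \<in> stratum n RayA \<and> fst (\<gamma> s) \<noteq> P)"
    by (intro exI[of _ "\<lambda>s. ((0, 0, 0, s), hom_pt 1 0)"] conjI poly_curveI)
      (auto simp: stratum_iff P_def)
qed

text \<open>This surface is \<open>x\<alpha> = t\<^sup>n\<beta>\<close> over the \<open>(x, t)\<close>-plane, so the point \<open>[1 : \<beta>]\<close> of the exceptional
  curve is reached along \<open>x = s\<^sup>n\<beta>\<close>, \<open>t = s\<close>, and \<open>[0 : 1]\<close> along the \<open>x\<close>-axis.\<close>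

lemma strict_transform_D2:
  assumes "n \<ge> 1"
  shows "strict_transform (X n) (D n 2) = stratum n RayB"
proof (rule strict_transform_eqI)
  show "zariski_closed (stratum n RayB)" by (rule zariski_closed_stratum)
next
  fix w assume w: "w \<in> X n" "fst w \<in> D n 2" "fst w \<noteq> P"
  then show "w \<in> stratum n RayB"
    by (cases w rule: aff4_proj1_normal_cases) (auto simp: X_iff stratum_iff D_def P_def)
next
  fix w assume "w \<in> stratum n RayB"
  then show "w \<in> X n \<and> fst w \<in> D n 2"
    by (cases w rule: aff4_proj1_normal_cases) (auto simp: X_iff stratum_iff D_def Y_def)
next
  fix w assume w: "w \<in> stratum n RayB" "fst w = P"
  show "\<exists>\<gamma>. poly_curve \<gamma> \<and> \<gamma> 0 = w \<and>
      (\<forall>s. s \<noteq> 0 \<longrightarrow> \<gamma> s \<in> stratum n RayB \<and> fst (\<gamma> s) \<noteq> P)"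
  proof (cases w rule: aff4_proj1_normal_cases)
    case (1 x y z t \<beta>)
    then show ?thesis using w assms
      by (intro exI[of _ "\<lambda>s. ((s ^ n * \<beta>, 0, 0, s), hom_pt 1 \<beta>)"] conjI poly_curveI)
        (auto simp: stratum_iff P_def)
  next
    case (2 x y z t)
    then show ?thesis using w assms
      by (intro exI[of _ "\<lambda>s. ((s, 0, 0, 0), hom_pt 0 1)"] conjI poly_curveI)
        (auto simp: stratum_iff P_def)
  qed
qed

text \<open>The quadric cone \<open>xz = y\<^sup>2\<close> is resolved, and \<open>[1 : \<beta>]\<close> is reached along the ruling
  \<open>(x, y, z) = s(\<beta>\<^sup>2, \<beta>, 1)\<close> of the cone.\<close>

lemma strict_transform_D3:
  assumes "n \<ge> 1"
  shows "strict_transform (X n) (D n 3) = stratum n RayT"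
proof (rule strict_transform_eqI)
  show "zariski_closed (stratum n RayT)" by (rule zariski_closed_stratum)
next
  fix w assume w: "w \<in> X n" "fst w \<in> D n 3" "fst w \<noteq> P"
  then show "w \<in> stratum n RayT" using assms
    by (cases w rule: aff4_proj1_normal_cases) (auto simp: X_iff stratum_iff D_def)
next
  fix w assume "w \<in> stratum n RayT"
  then show "w \<in> X n \<and> fst w \<in> D n 3" using assms
    by (cases w rule: aff4_proj1_normal_cases)
      (auto simp: X_iff stratum_iff D_def Y_def power2_eq_square)
next
  fix w assume w: "w \<in> stratum n RayT" "fst w = P"
  show "\<exists>\<gamma>. poly_curve \<gamma> \<and> \<gamma> 0 = w \<and>
      (\<forall>s. s \<noteq> 0 \<longrightarrow> \<gamma> s \<in> stratum n RayT \<and> fst (\<gamma> s) \<noteq> P)"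
  proof (cases w rule: aff4_proj1_normal_cases)
    case (1 x y z t \<beta>)
    then show ?thesis using w
      by (intro exI[of _ "\<lambda>s. ((s * \<beta> * \<beta>, s * \<beta>, s, 0), hom_pt 1 \<beta>)"] conjI poly_curveI)
        (auto simp: stratum_iff P_def)
  next
    case (2 x y z t)
    then show ?thesis using w
      by (intro exI[of _ "\<lambda>s. ((s, 0, 0, 0), hom_pt 0 1)"] conjI poly_curveI)
        (auto simp: stratum_iff P_def)
  qed
qed

section \<open>The reflection exchanging the two extractions\<close>

text \<open>The reflection exchanges \<open>x\<close> and \<open>z\<close> and fixes the projective coordinate. It preserves all the
  notions from which strata are built, since it is an involution that permutes polynomial functions.\<close>

definition flip :: "aff4 \<Rightarrow> aff4" where
  "flip = (\<lambda>(x, y, z, t). (z, y, x, t))"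

definition mirror :: "aff4 \<times> proj1 \<Rightarrow> aff4 \<times> proj1" where
  "mirror = map_prod flip id"

lemma mirror_simps [simp]:
  "mirror ((x, y, z, t), q) = ((z, y, x, t), q)" "mirror (mirror w) = w"
  by (auto simp: mirror_def flip_def map_prod_def split: prod.splits)

lemma mirror_image_eq: "mirror ` S = mirror -` S"
  by (force simp: image_iff)

lemma mirror_image_image [simp]: "mirror ` mirror ` S = S"
  by (simp add: image_image)

lemma mirror_image_subset_iff: "mirror ` S \<subseteq> T \<longleftrightarrow> S \<subseteq> mirror ` T"
  by (metis image_mono mirror_image_image)

lemma mem_mirror_image_iff: "w \<in> mirror ` S \<longleftrightarrow> mirror w \<in> S"
  by (simp add: mirror_image_eq)

lemma inj_mirror: "inj mirror"
  by (metis injI mirror_simps(2))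

lemma poly_fun_flip: "poly_fun g \<Longrightarrow> poly_fun (\<lambda>p. g (flip p))"
  by (induction rule: poly_fun.induct) (auto simp: flip_def split_beta' intro: poly_fun.intros[unfolded split_beta'])

lemma zariski_closed_mirror:
  assumes "zariski_closed A" shows "zariski_closed (mirror ` A)"
proof -
  obtain F where F: "\<forall>(d, g) \<in> F. \<forall>i. poly_fun (g i)" "A = (\<Inter>(d, g) \<in> F. form_zeros d g)"
    using assms unfolding zariski_closed_def by blast
  let ?flip = "\<lambda>(d, g). (d, \<lambda>i p. g i (flip p))"
  have "mirror -` form_zeros d g = form_zeros d (\<lambda>i p. g i (flip p))" for d g
    by (intro set_eqI, rule_tac w = x in aff4_proj1_cases) (simp add: form_zeros_iff flip_def)
  then have "mirror ` A = (\<Inter>(d, g) \<in> ?flip ` F. form_zeros d g)"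
    unfolding mirror_image_eq F(2) by (auto simp: vimage_INT split_beta)
  moreover have "\<forall>(d, g) \<in> ?flip ` F. \<forall>i. poly_fun (g i)"
    using F(1) poly_fun_flip by auto
  ultimately show ?thesis unfolding zariski_closed_def by blast
qed

lemma irreducible_set_mirror:
  assumes "irreducible_set T" shows "irreducible_set (mirror ` T)"
  unfolding irreducible_set_def
proof (intro conjI allI impI)
  show "mirror ` T \<noteq> {}" using assms by (simp add: irreducible_set_def)
  fix A B assume *: "zariski_closed A \<and> zariski_closed B \<and> mirror ` T \<subseteq> A \<union> B"
  then have "T \<subseteq> mirror ` A \<union> mirror ` B" by (simp add: mirror_image_subset_iff image_Un)
  then have "T \<subseteq> mirror ` A \<or> T \<subseteq> mirror ` B"
    using assms * zariski_closed_mirror unfolding irreducible_set_def by metis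
  then show "mirror ` T \<subseteq> A \<or> mirror ` T \<subseteq> B" by (simp add: mirror_image_subset_iff)
qed

lemma irreducible_components_mirror:
  "irreducible_components (mirror ` S) = (`) mirror ` irreducible_components S"
proof -
  have sub: "mirror ` T \<in> irreducible_components (mirror ` S)"
    if T: "T \<in> irreducible_components S" for S T
  proof -
    have "T' = mirror ` T" if "mirror ` T \<subseteq> T'" "T' \<subseteq> mirror ` S" "irreducible_set T'" for T'
    proof -
      have "T \<subseteq> mirror ` T'" "mirror ` T' \<subseteq> S"
        using image_mono[OF that(1), of mirror] image_mono[OF that(2), of mirror] by simp_all
      then have "mirror ` T' = T"
        using T irreducible_set_mirror[OF that(3)] unfolding irreducible_components_def by auto
      then show ?thesis using mirror_image_image by metis
    qed
    then show ?thesis using T irreducible_set_mirror unfolding irreducible_components_def by auto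
  qed
  show ?thesis
  proof
    show "(`) mirror ` irreducible_components S \<subseteq> irreducible_components (mirror ` S)"
      using sub by auto
    show "irreducible_components (mirror ` S) \<subseteq> (`) mirror ` irreducible_components S"
    proof
      fix T assume "T \<in> irreducible_components (mirror ` S)"
      then have "mirror ` T \<in> irreducible_components S" using sub[of T "mirror ` S"] by simp
      then show "T \<in> (`) mirror ` irreducible_components S"
        by (intro image_eqI[of _ _ "mirror ` T"]) simp_all
    qed
  qed
qed

lemma strata_mirror: "strata I (\<lambda>i. mirror ` E i) k = (`) mirror ` strata I E k"
proof -
  have curves: "curve_strata I (\<lambda>i. mirror ` E i) = (`) mirror ` curve_strata I E"
    unfolding curve_strata_def
    by (simp add: image_UN irreducible_components_mirror flip: image_Int[OF inj_mirror])
  let ?meet = "\<lambda>C w. \<exists>S\<in>C. \<exists>T\<in>C. S \<noteq> T \<and> w \<in> S \<and> w \<in> T"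
  have points: "strata I E 0 = (\<lambda>w. {w}) ` {w. ?meet (curve_strata I E) w}" for E
    unfolding strata_def image_Collect by simp
  have "?meet ((`) mirror ` C) w \<longleftrightarrow> ?meet C (mirror w)" for C w
    by (simp add: inj_image_eq_iff[OF inj_mirror] mem_mirror_image_iff)
  then have "{w. ?meet ((`) mirror ` C) w} = mirror ` {w. ?meet C w}" for C
    by (intro set_eqI) (simp only: mem_mirror_image_iff mem_Collect_eq)
  then have "strata I (\<lambda>i. mirror ` E i) 0 = (`) mirror ` strata I E 0"
    unfolding points curves by (simp add: image_image)
  then show ?thesis using curves by (cases "k = 0") (auto simp: strata_def image_image)
qed

text \<open>The blowup has the equations of \<open>X\<close> with \<open>x\<close> and \<open>z\<close> exchanged. They hold on the graph of
  \<open>[x : y]\<close>, which contains all their solutions with \<open>(x, y) \<noteq> (0, 0)\<close>. The solutions with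
  \<open>x = y = 0\<close> are limits of the graph: at \<open>[1 : \<beta>]\<close> the coordinates \<open>x\<close>, \<open>t\<close>, \<open>\<beta>\<close> are free, so
  \<open>x\<close> can be moved, and at \<open>[0 : 1]\<close> the coordinates \<open>z\<close>, \<open>t\<close>, \<open>\<alpha>\<close> are free and \<open>t = 0\<close>, so
  moving \<open>t\<close> makes \<open>y = -t\<^sup>n\<close> different from 0.\<close>

lemma X'_eq_mirror:
  assumes "n \<ge> 1" shows "X' n = mirror ` X n"
proof -
  let ?S = "locus (\<lambda>x y z t \<alpha> \<beta>. y * \<alpha> = x * \<beta> \<and> z * \<alpha> = (y + t ^ n) * \<beta>)"
  have alg: "closed_condition (\<lambda>x y z t \<alpha> \<beta>. y * \<alpha> = x * \<beta> \<and> z * \<alpha> = (y + t ^ n) * \<beta>)"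
    by (intro closed_condition_conj closed_condition_basic)
  then have S_iff: "((x, y, z, t), hom_pt \<alpha> \<beta>) \<in> ?S \<longleftrightarrow> y * \<alpha> = x * \<beta> \<and> z * \<alpha> = (y + t ^ n) * \<beta>"
    if "(\<alpha>, \<beta>) \<noteq> (0, 0)" for x y z t \<alpha> \<beta>
    using that locus_iff unfolding closed_condition_def by blast
  let ?G = "{(p, hom_pt ((\<lambda>(x, y, z, t). x) p) ((\<lambda>(x, y, z, t). y) p)) | p.
    p \<in> Y n \<and> ((\<lambda>(x, y, z, t). x) p, (\<lambda>(x, y, z, t). y) p) \<noteq> (0, 0)}"
  have G: "((x, y, z, t), hom_pt \<alpha> \<beta>) \<in> ?G"
    if S: "((x, y, z, t), hom_pt \<alpha> \<beta>) \<in> ?S" and nz: "(\<alpha>, \<beta>) \<noteq> (0, 0)" "(x, y) \<noteq> (0, 0)" for x y z t \<alpha> \<beta>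
  proof -
    have e: "y * \<alpha> = x * \<beta>" "z * \<alpha> = (y + t ^ n) * \<beta>" using S S_iff[OF nz(1)] by auto
    obtain c where c: "c \<noteq> 0" "x = c * \<alpha>" "y = c * \<beta>"
    proof (cases "\<alpha> = 0")
      case True
      then show ?thesis using e nz that[of "y / \<beta>"] by auto
    next
      case False
      then have "x \<noteq> 0" using e(1) nz(2) by auto
      then show ?thesis using e False that[of "x / \<alpha>"] by (auto simp: field_simps)
    qed
    have "x * z = c * (z * \<alpha>)" by (simp add: c)
    also have "\<dots> = y * (y + t ^ n)" unfolding e(2) by (simp add: c)
    finally have "x * z = y * (y + t ^ n)" .
    moreover have "hom_pt \<alpha> \<beta> = hom_pt x y" using hom_pt_scale[OF c(1) nz(1)] c by simp
    ultimately show ?thesis using nz by (auto simp: Y_def)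
  qed
  have "X' n = ?S"
    unfolding X'_def blowup_def
  proof (rule hull_unique)
    show "?G \<subseteq> ?S" by (auto simp: S_iff Y_def) (simp_all add: mult.commute)
    show "zariski_closed ?S" using alg by (simp add: closed_condition_def)
    fix A assume A: "?G \<subseteq> A" "zariski_closed A"
    show "?S \<subseteq> A"
    proof
      fix w assume w: "w \<in> ?S"
      then show "w \<in> A"
      proof (cases w rule: aff4_proj1_normal_cases)
        case (1 x y z t \<beta>)
        show ?thesis
        proof (cases "(x, y) = (0, 0)")
          case True
          then have "z = t ^ n * \<beta>" using w 1 S_iff[of 1 \<beta>] by auto
          moreover have "((s, s * \<beta>, (s * \<beta> + t ^ n) * \<beta>, t), hom_pt 1 \<beta>) \<in> A" if "s \<noteq> 0" for s
            using A(1) G[of s "s * \<beta>" _ t 1 \<beta>] that by (auto simp: S_iff)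
          then have "((0, 0 * \<beta>, (0 * \<beta> + t ^ n) * \<beta>, t), hom_pt 1 \<beta>) \<in> A"
            by (intro poly_curve_limit[OF A(2), where \<gamma> = "\<lambda>s. ((s, s * \<beta>, (s * \<beta> + t ^ n) * \<beta>, t), hom_pt 1 \<beta>)"]
                poly_curveI) auto
          ultimately show ?thesis using 1 True by simp
        next
          case False
          then show ?thesis using w 1 G[of x y z t 1 \<beta>] A(1) by auto
        qed
      next
        case (2 x y z t)
        show ?thesis
        proof (cases "(x, y) = (0, 0)")
          case True
          then have t: "t = 0" using w 2 S_iff[of 0 1] by auto
          have "((0, - (s ^ n), z, s), hom_pt 0 1) \<in> A" if "s \<noteq> 0" for s
            using A(1) G[of 0 "- (s ^ n)" z s 0 1] that by (auto simp: S_iff)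
          then have "((0, - (0 ^ n), z, 0), hom_pt 0 1) \<in> A"
            by (intro poly_curve_limit[OF A(2), where \<gamma> = "\<lambda>s. ((0, - (s ^ n), z, s), hom_pt 0 1)"]
                poly_curveI) auto
          moreover have "(0 :: complex) ^ n = 0" using assms by simp
          ultimately show ?thesis using 2 True t by simp
        next
          case False
          then show ?thesis using w 2 G[of x y z t 0 1] A(1) by auto
        qed
      qed
    qed
  qed
  also have "?S = mirror ` X n"
    unfolding mirror_image_eq
    by (intro set_eqI, rule_tac w = x in aff4_proj1_cases) (simp add: S_iff X_iff)
  finally show ?thesis .
qed

lemma flip_D:
  "flip p \<in> D n 1 \<longleftrightarrow> p \<in> D n 2" "flip p \<in> D n 2 \<longleftrightarrow> p \<in> D n 1" "flip p \<in> D n 3 \<longleftrightarrow> p \<in> D n 3"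
  by (cases p; auto simp: flip_def D_def Y_def mult.commute)+

text \<open>The exceptional point \<open>P\<close> is fixed by the reflection, so preimages of \<open>E - {P}\<close> go to preimages
  of \<open>E' - {P}\<close>.\<close>

lemma strict_transform_mirror:
  assumes "strict_transform Z E = F" "zariski_closed F" "\<And>p. flip p \<in> E \<longleftrightarrow> p \<in> E'"
  shows "strict_transform (mirror ` Z) E' = mirror ` F"
  unfolding strict_transform_def
proof (rule hull_unique)
  let ?T = "{w \<in> Z. fst w \<in> E - {P}}"
  have "fst (mirror w) = flip (fst w)" "flip (flip (fst w)) = fst w" "flip (fst w) = P \<longleftrightarrow> fst w = P" for w :: "aff4 \<times> proj1"
    by (auto simp: mirror_def flip_def P_def split: prod.splits)
  then have T: "{w \<in> mirror ` Z. fst w \<in> E' - {P}} = mirror ` ?T"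
    unfolding mirror_image_eq using assms(3) by auto
  have F: "F = zariski_closed hull ?T" using assms(1) unfolding strict_transform_def by simp
  have "?T \<subseteq> F" unfolding F by (rule hull_subset)
  then show "{w \<in> mirror ` Z. fst w \<in> E' - {P}} \<subseteq> mirror ` F" unfolding T by blast
  show "zariski_closed (mirror ` F)" using assms(2) by (rule zariski_closed_mirror)
  fix A assume A: "{w \<in> mirror ` Z. fst w \<in> E' - {P}} \<subseteq> A" "zariski_closed A"
  then have "?T \<subseteq> mirror ` A" unfolding T by (simp add: mirror_image_subset_iff)
  then have "F \<subseteq> mirror ` A"
    unfolding F using zariski_closed_mirror[OF A(2)] by (rule hull_minimal)
  then show "mirror ` F \<subseteq> A" by (simp add: mirror_image_subset_iff)
qed

section \<open>The cones of the two subdivisions\<close>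

definition halfline :: "trop \<Rightarrow> trop set" where
  "halfline u = {s *\<^sub>R u | s. s \<ge> 0}"

lemma convex_cone_halfline: "convex_cone (halfline u)"
  unfolding convex_cone_iff
proof (intro conjI ballI allI impI)
  show "0 \<in> halfline u" unfolding halfline_def by (auto intro: exI[of _ 0])
next
  fix x y assume "x \<in> halfline u" "y \<in> halfline u"
  then obtain s t where "x = s *\<^sub>R u" "y = t *\<^sub>R u" "s \<ge> 0" "t \<ge> 0" by (auto simp: halfline_def)
  then show "x + y \<in> halfline u" unfolding halfline_def
    by (intro CollectI exI[of _ "s + t"]) (simp add: scaleR_add_left)
next
  fix x :: trop and c :: real assume "x \<in> halfline u" "0 \<le> c"
  then obtain s where "x = s *\<^sub>R u" "s \<ge> 0" by (auto simp: halfline_def)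
  then show "c *\<^sub>R x \<in> halfline u" unfolding halfline_def
    using \<open>0 \<le> c\<close> by (intro CollectI exI[of _ "c * s"]) simp
qed

lemma cone_2:
  "convex_cone hull (halfline u \<union> halfline v) = {p *\<^sub>R u + q *\<^sub>R v | p q. p \<ge> 0 \<and> q \<ge> 0}"
  unfolding convex_cone_hull_Un hull_same[of convex_cone, OF convex_cone_halfline]
  unfolding halfline_def by blast

lemma cone_3:
  "convex_cone hull (halfline u \<union> halfline v \<union> halfline w) =
     {p *\<^sub>R u + q *\<^sub>R v + r *\<^sub>R w | p q r. p \<ge> 0 \<and> q \<ge> 0 \<and> r \<ge> 0}"
  unfolding convex_cone_hull_Un[of "halfline u \<union> halfline v"] cone_2
    hull_same[of convex_cone, OF convex_cone_halfline]
  unfolding halfline_def by blast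

lemma ray_eq: "ray i = halfline (gen i)"
  by (simp add: ray_def halfline_def)

lemma ell_plus_eq: "ell_plus n = halfline (real n, real n, 1)"
  by (simp add: ell_plus_def halfline_def)

lemma mem_ray:
  "(a, b, c) \<in> ray 1 \<longleftrightarrow> a = b \<and> c = 0 \<and> 0 \<le> a"
  "(a, b, c) \<in> ray 2 \<longleftrightarrow> a = 0 \<and> c = 0 \<and> 0 \<le> b"
  "(a, b, c) \<in> ray 3 \<longleftrightarrow> a = 0 \<and> b = 0 \<and> 0 \<le> c"
  by (auto simp: ray_def gen_def)

lemma mem_trop_sigma:
  "(a, b, c) \<in> trop_sigma n \<longleftrightarrow> 0 \<le> a \<and> 0 \<le> c \<and> a \<le> 2 * b \<and> a \<le> b + real n * c"
  by (auto simp: trop_sigma_def)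

lemma mem_tau1:
  assumes "n \<ge> 1"
  shows "(a, b, c) \<in> tau1 n \<longleftrightarrow> 0 \<le> a \<and> a \<le> b \<and> a \<le> real n * c"
proof
  assume "(a, b, c) \<in> tau1 n"
  then obtain p q r :: real where "0 \<le> p" "0 \<le> q" "0 \<le> r" "a = r * n" "b = p + r * n" "c = q + r"
    unfolding tau1_def ray_eq ell_plus_eq cone_3 by (auto simp: gen_def)
  then show "0 \<le> a \<and> a \<le> b \<and> a \<le> real n * c" by (simp add: algebra_simps)
next
  assume "0 \<le> a \<and> a \<le> b \<and> a \<le> real n * c"
  then show "(a, b, c) \<in> tau1 n"
    unfolding tau1_def ray_eq ell_plus_eq cone_3 using assms
    by (intro CollectI exI[of _ "b - a"] exI[of _ "c - a / n"] exI[of _ "a / n"])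
      (auto simp: gen_def field_simps)
qed

lemma mem_Pi_L:
  assumes "n \<ge> 1"
  shows "(a, b, c) \<in> Pi_L n \<longleftrightarrow> 0 \<le> a \<and> a = min b (real n * c)"
proof
  assume "(a, b, c) \<in> Pi_L n"
  then obtain p q :: real where "0 \<le> p" "0 \<le> q"
    "a = q * n \<and> b = p + q * n \<and> c = q \<or> a = p * n \<and> b = p * n \<and> c = p + q"
    unfolding Pi_L_def ray_eq ell_plus_eq cone_2 by (auto simp: gen_def)
  then show "0 \<le> a \<and> a = min b (real n * c)" by (auto simp: algebra_simps)
next
  assume a: "0 \<le> a \<and> a = min b (real n * c)"
  show "(a, b, c) \<in> Pi_L n"
  proof (cases "b \<le> real n * c")
    case True
    then have "(a, b, c) \<in> convex_cone hull (ell_plus n \<union> ray 3)"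
      unfolding ray_eq ell_plus_eq cone_2 using assms a
      by (intro CollectI exI[of _ "a / n"] exI[of _ "c - a / n"]) (auto simp: gen_def field_simps)
    then show ?thesis by (simp add: Pi_L_def)
  next
    case False
    then have "(a, b, c) \<in> convex_cone hull (ray 2 \<union> ell_plus n)"
      unfolding ray_eq ell_plus_eq cone_2 using assms a
      by (intro CollectI exI[of _ "b - a"] exI[of _ c]) (auto simp: gen_def zero_le_mult_iff)
    then show ?thesis by (simp add: Pi_L_def)
  qed
qed

lemma mem_Pi_R: "(a, b, c) \<in> Pi_R \<longleftrightarrow> 0 \<le> a \<and> 0 \<le> c \<and> a = b"
  unfolding Pi_R_def ray_eq cone_2 by (auto simp: gen_def)

lemma mem_simplex_R: "(a, b, c) \<in> simplex_R \<longleftrightarrow> 0 \<le> a \<and> 0 \<le> c \<and> a \<le> b"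
proof
  assume "(a, b, c) \<in> simplex_R"
  then show "0 \<le> a \<and> 0 \<le> c \<and> a \<le> b"
    unfolding simplex_R_def ray_eq cone_3 by (auto simp: gen_def)
next
  assume "0 \<le> a \<and> 0 \<le> c \<and> a \<le> b"
  then show "(a, b, c) \<in> simplex_R"
    unfolding simplex_R_def ray_eq cone_3
    by (intro CollectI exI[of _ a] exI[of _ "b - a"] exI[of _ c]) (auto simp: gen_def)
qed

text \<open>Taking the closure of a chamber complement turns \<open>a > f\<close> into \<open>a \<ge> f\<close>. A point of \<open>\<sigma>\<close> with
  \<open>a = f\<close> is approached by moving in the direction \<open>(n + 1, n, 1)\<close>: this stays in \<open>\<sigma>\<close>, for which
  \<open>n \<ge> 1\<close> is needed, and \<open>f\<close> grows with slope \<open>n\<close> only. Both \<open>b\<close> and \<open>min b (nc)\<close> have this slope,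
  as \<open>\<ell>\<close> is where they agree and the direction is \<open>(n, n, 1) + (1, 0, 0)\<close>.\<close>

lemma closure_trop_sigma_diff:
  assumes n: "n \<ge> 1" and cont: "continuous_on UNIV f"
    and slope: "\<And>a b c e :: real. f (a + e * (real n + 1), b + e * real n, c + e) = f (a, b, c) + e * real n"
    and T: "\<And>a b c. (a, b, c) \<in> trop_sigma n \<Longrightarrow> (a, b, c) \<in> T \<longleftrightarrow> a \<le> f (a, b, c)"
  shows "closure (trop_sigma n - T) = trop_sigma n \<inter> {p. f p \<le> fst p}"
proof
  have "trop_sigma n = {p. 0 \<le> fst p} \<inter> {p. 0 \<le> snd (snd p)} \<inter> {p. fst p \<le> 2 * fst (snd p)} \<inter>
      {p. fst p \<le> fst (snd p) + real n * snd (snd p)}"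
    by (auto simp: trop_sigma_def)
  moreover have "closed \<dots>"
    by (intro closed_Int closed_Collect_le continuous_intros)
  ultimately have "closed (trop_sigma n \<inter> {p. f p \<le> fst p})"
    using cont by (auto intro!: closed_Int closed_Collect_le continuous_intros)
  then show "closure (trop_sigma n - T) \<subseteq> trop_sigma n \<inter> {p. f p \<le> fst p}"
    by (intro closure_minimal) (auto simp: T)
next
  show "trop_sigma n \<inter> {p. f p \<le> fst p} \<subseteq> closure (trop_sigma n - T)"
  proof
    fix p assume p: "p \<in> trop_sigma n \<inter> {p. f p \<le> fst p}"
    obtain a b c where abc: "p = (a, b, c)" by (metis surj_pair)
    let ?d = "(real n + 1, real n, 1) :: trop"
    show "p \<in> closure (trop_sigma n - T)"
      unfolding closure_approachable
    proof (intro allI impI)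
      fix r :: real assume r: "r > 0"
      \<comment> \<open>The summand 1 keeps the denominator positive and makes the inequality below strict.\<close>
      define e where "e = r / (norm ?d + 1)"
      have pos: "norm ?d + 1 > 0" using norm_ge_zero[of ?d] by linarith
      then have e: "e > 0" using r by (simp add: e_def)
      have "e * norm ?d < e * (norm ?d + 1)" using e by simp
      also have "\<dots> = r" using pos by (simp add: e_def)
      finally have "norm (e *\<^sub>R ?d) < r" using e by (simp only: norm_scaleR abs_of_pos)
      then have d: "dist (p + e *\<^sub>R ?d) p < r" by (simp only: dist_norm add_diff_cancel_left')
      have q: "p + e *\<^sub>R ?d = (a + e * (real n + 1), b + e * real n, c + e)" by (simp add: abc)
      have "e \<le> e * real n" using e n by simp
      then have "(a + e * (real n + 1), b + e * real n, c + e) \<in> trop_sigma n"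
        using p[unfolded abc Int_iff mem_trop_sigma] e unfolding mem_trop_sigma
        by (intro conjI; simp only: algebra_simps; linarith)
      moreover have "f (a, b, c) + e * real n < a + e * (real n + 1)"
        using p e by (simp add: abc algebra_simps)
      ultimately have "(a + e * (real n + 1), b + e * real n, c + e) \<in> trop_sigma n - T"
        by (simp add: T slope)
      then show "\<exists>y\<in>trop_sigma n - T. dist y p < r" using d unfolding q by blast
    qed
  qed
qed

lemma tau2_eq:
  assumes "n \<ge> 1"
  shows "tau2 n = trop_sigma n \<inter> {(a, b, c). min b (real n * c) \<le> a}"
proof -
  let ?f = "\<lambda>p :: trop. min (fst (snd p)) (real n * snd (snd p))"
  have "tau2 n = trop_sigma n \<inter> {p. ?f p \<le> fst p}"
    unfolding tau2_def
  proof (rule closure_trop_sigma_diff[OF assms])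
    show "continuous_on UNIV ?f" by (intro continuous_intros)
    show "?f (a + e * (real n + 1), b + e * real n, c + e) = ?f (a, b, c) + e * real n"
      for a b c e :: real
      by (simp add: min_def algebra_simps)
    show "(a, b, c) \<in> tau1 n \<longleftrightarrow> a \<le> ?f (a, b, c)" if "(a, b, c) \<in> trop_sigma n" for a b c
      using that by (simp add: mem_tau1[OF assms] trop_sigma_def)
  qed
  then show ?thesis by (simp add: case_prod_unfold)
qed

lemma closure_simplex_complement:
  assumes "n \<ge> 1"
  shows "closure (trop_sigma n - simplex_R) = trop_sigma n \<inter> {(a, b, c). b \<le> a}"
proof -
  have "closure (trop_sigma n - simplex_R) = trop_sigma n \<inter> {p. fst (snd p) \<le> fst p}"
  proof (rule closure_trop_sigma_diff[OF assms])
    show "continuous_on UNIV (\<lambda>p :: trop. fst (snd p))" by (intro continuous_intros)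
    show "(a, b, c) \<in> simplex_R \<longleftrightarrow> a \<le> fst (snd (a, b, c))" if "(a, b, c) \<in> trop_sigma n" for a b c
      using that by (simp add: mem_simplex_R trop_sigma_def)
  qed simp
  then show ?thesis by (simp add: case_prod_unfold)
qed

section \<open>Inclusions between the cells\<close>

text \<open>In \<open>cell_R\<close> the rays 1 and 2 have exchanged their labels, and accordingly so have the faces \<open>a = 0\<close>
  and \<open>a = b + min b (nc)\<close>.\<close>

fun cell_L :: "nat \<Rightarrow> face \<Rightarrow> trop set" where
  "cell_L n RayA = ray 1"
| "cell_L n RayB = ray 2"
| "cell_L n RayT = ray 3"
| "cell_L n FaceAB = trop_sigma n \<inter> {(a, b, c). c = 0}"
| "cell_L n FaceAT = trop_sigma n \<inter> {(a, b, c). a = b + min b (real n * c)}"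
| "cell_L n FaceBT = trop_sigma n \<inter> {(a, b, c). a = 0}"
| "cell_L n Wall = Pi_L n"
| "cell_L n ChamberABT = tau2 n"
| "cell_L n ChamberBT = tau1 n"

fun cell_R :: "nat \<Rightarrow> face \<Rightarrow> trop set" where
  "cell_R n RayA = ray 2"
| "cell_R n RayB = ray 1"
| "cell_R n RayT = ray 3"
| "cell_R n FaceAB = trop_sigma n \<inter> {(a, b, c). c = 0}"
| "cell_R n FaceAT = trop_sigma n \<inter> {(a, b, c). a = 0}"
| "cell_R n FaceBT = trop_sigma n \<inter> {(a, b, c). a = b + min b (real n * c)}"
| "cell_R n Wall = Pi_R"
| "cell_R n ChamberABT = simplex_R"
| "cell_R n ChamberBT = closure (trop_sigma n - simplex_R)"

lemma cells_L_eq: "cells_L n = range (cell_L n)"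
  unfolding cells_L_def sigma_faces_def UNIV_face by auto

lemma cells_R_eq: "cells_R n = range (cell_R n)"
  unfolding cells_R_def sigma_faces_def UNIV_face by auto

text \<open>The cells in the coordinates \<open>a\<close>, \<open>b\<close>, \<open>d = nc\<close>, in which they do not depend on \<open>n\<close>.\<close>

fun ineqs_L :: "face \<Rightarrow> real \<Rightarrow> real \<Rightarrow> real \<Rightarrow> bool" where
  "ineqs_L RayA a b d \<longleftrightarrow> a = b \<and> d = 0 \<and> 0 \<le> a"
| "ineqs_L RayB a b d \<longleftrightarrow> a = 0 \<and> d = 0 \<and> 0 \<le> b"
| "ineqs_L RayT a b d \<longleftrightarrow> a = 0 \<and> b = 0 \<and> 0 \<le> d"
| "ineqs_L FaceAB a b d \<longleftrightarrow> d = 0 \<and> 0 \<le> a \<and> a \<le> b"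
| "ineqs_L FaceAT a b d \<longleftrightarrow> a = b + min b d \<and> 0 \<le> b \<and> 0 \<le> d"
| "ineqs_L FaceBT a b d \<longleftrightarrow> a = 0 \<and> 0 \<le> b \<and> 0 \<le> d"
| "ineqs_L Wall a b d \<longleftrightarrow> a = min b d \<and> 0 \<le> a"
| "ineqs_L ChamberABT a b d \<longleftrightarrow> 0 \<le> a \<and> 0 \<le> d \<and> min b d \<le> a \<and> a \<le> b + min b d"
| "ineqs_L ChamberBT a b d \<longleftrightarrow> 0 \<le> a \<and> a \<le> min b d"

fun ineqs_R :: "face \<Rightarrow> real \<Rightarrow> real \<Rightarrow> real \<Rightarrow> bool" where
  "ineqs_R RayA a b d \<longleftrightarrow> a = 0 \<and> d = 0 \<and> 0 \<le> b"
| "ineqs_R RayB a b d \<longleftrightarrow> a = b \<and> d = 0 \<and> 0 \<le> a"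
| "ineqs_R RayT a b d \<longleftrightarrow> a = 0 \<and> b = 0 \<and> 0 \<le> d"
| "ineqs_R FaceAB a b d \<longleftrightarrow> d = 0 \<and> 0 \<le> a \<and> a \<le> b"
| "ineqs_R FaceAT a b d \<longleftrightarrow> a = 0 \<and> 0 \<le> b \<and> 0 \<le> d"
| "ineqs_R FaceBT a b d \<longleftrightarrow> a = b + min b d \<and> 0 \<le> b \<and> 0 \<le> d"
| "ineqs_R Wall a b d \<longleftrightarrow> a = b \<and> 0 \<le> a \<and> 0 \<le> d"
| "ineqs_R ChamberABT a b d \<longleftrightarrow> 0 \<le> a \<and> a \<le> b \<and> 0 \<le> d"
| "ineqs_R ChamberBT a b d \<longleftrightarrow> 0 \<le> a \<and> 0 \<le> d \<and> b \<le> a \<and> a \<le> b + min b d"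

lemma mem_cell:
  assumes "n \<ge> 1"
  shows "(a, b, c) \<in> cell_L n f \<longleftrightarrow> ineqs_L f a b (real n * c)"
    "(a, b, c) \<in> cell_R n f \<longleftrightarrow> ineqs_R f a b (real n * c)"
proof -
  define d where "d = real n * c"
  have sgn: "0 \<le> c \<longleftrightarrow> 0 \<le> d" "c = 0 \<longleftrightarrow> d = 0"
    using assms by (auto simp: d_def zero_le_mult_iff)
  show "(a, b, c) \<in> cell_L n f \<longleftrightarrow> ineqs_L f a b (real n * c)"
    by (cases f; simp only: cell_L.simps ineqs_L.simps mem_ray mem_tau1[OF assms] mem_Pi_L[OF assms]
        tau2_eq[OF assms] mem_trop_sigma Int_iff mem_Collect_eq case_prod_conv sgn
        d_def[symmetric]) (auto simp: min_def)
  show "(a, b, c) \<in> cell_R n f \<longleftrightarrow> ineqs_R f a b (real n * c)"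
    by (cases f; simp only: cell_R.simps ineqs_R.simps mem_ray mem_Pi_R mem_simplex_R
        closure_simplex_complement[OF assms] mem_trop_sigma Int_iff mem_Collect_eq case_prod_conv
        sgn d_def[symmetric]) (auto simp: min_def)
qed

text \<open>A point, in the same coordinates, of the relative interior of each cell. As for the strata,
  it decides all inclusions.\<close>

fun generic_L :: "face \<Rightarrow> real \<times> real \<times> real" where
  "generic_L RayA = (1, 1, 0)"
| "generic_L RayB = (0, 1, 0)"
| "generic_L RayT = (0, 0, 1)"
| "generic_L FaceAB = (1, 2, 0)"
| "generic_L FaceAT = (2, 1, 1)"
| "generic_L FaceBT = (0, 1, 1)"
| "generic_L Wall = (1, 1, 1)"
| "generic_L ChamberABT = (3, 2, 2)"
| "generic_L ChamberBT = (1, 2, 2)"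

fun generic_R :: "face \<Rightarrow> real \<times> real \<times> real" where
  "generic_R RayA = (0, 1, 0)"
| "generic_R RayB = (1, 1, 0)"
| "generic_R RayT = (0, 0, 1)"
| "generic_R FaceAB = (1, 2, 0)"
| "generic_R FaceAT = (0, 1, 1)"
| "generic_R FaceBT = (2, 1, 1)"
| "generic_R Wall = (1, 1, 1)"
| "generic_R ChamberABT = (1, 2, 2)"
| "generic_R ChamberBT = (3, 2, 2)"

lemma cell_subset_iff:
  fixes cell :: "face \<Rightarrow> trop set"
  assumes "n \<ge> 1" and mem: "\<And>f a b c. (a, b, c) \<in> cell f \<longleftrightarrow> I f a b (real n * c)"
    and mono: "\<And>f g a b d. f \<in> subfaces g \<Longrightarrow> I f a b d \<Longrightarrow> I g a b d"
    and generic: "\<And>f g a b d. p f = (a, b, d) \<Longrightarrow> I g a b d \<longleftrightarrow> f \<in> subfaces g"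
  shows "cell f \<subseteq> cell g \<longleftrightarrow> f \<in> subfaces g"
proof
  assume sub: "cell f \<subseteq> cell g"
  obtain a b d where p: "p f = (a, b, d)" by (metis surj_pair)
  have d: "real n * (d / real n) = d" using assms(1) by simp
  have "f \<in> subfaces f" by (cases f) auto
  then have "(a, b, d / real n) \<in> cell f" unfolding mem d generic[OF p] .
  then have "(a, b, d / real n) \<in> cell g" using sub by blast
  then show "f \<in> subfaces g" unfolding mem d generic[OF p] .
next
  assume "f \<in> subfaces g"
  then show "cell f \<subseteq> cell g" using mem mono by auto
qed

lemma cell_L_subset_iff: "n \<ge> 1 \<Longrightarrow> cell_L n f \<subseteq> cell_L n g \<longleftrightarrow> f \<in> subfaces g"
proof (rule cell_subset_iff[where I = ineqs_L and p = generic_L])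
  show "ineqs_L g a b d" if "f \<in> subfaces g" "ineqs_L f a b d" for f g a b d
    using that by (cases g) (auto simp: min_def split: if_splits)
  show "ineqs_L g a b d \<longleftrightarrow> f \<in> subfaces g" if "generic_L f = (a, b, d)" for f g a b d
    using that by (cases f; cases g) auto
qed (auto simp: mem_cell)

lemma cell_R_subset_iff: "n \<ge> 1 \<Longrightarrow> cell_R n f \<subseteq> cell_R n g \<longleftrightarrow> f \<in> subfaces g"
proof (rule cell_subset_iff[where I = ineqs_R and p = generic_R])
  show "ineqs_R g a b d" if "f \<in> subfaces g" "ineqs_R f a b d" for f g a b d
    using that by (cases g) (auto simp: min_def split: if_splits)
  show "ineqs_R g a b d \<longleftrightarrow> f \<in> subfaces g" if "generic_R f = (a, b, d)" for f g a b d
    using that by (cases f; cases g) auto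
qed (auto simp: mem_cell)

section \<open>Dimensions of the cells\<close>

lemma chart_H_eq: "chart_H n (a, b, c) = (a + max 0 (real n * c - b), b, c)"
proof -
  have "inj (M_ell n)" by (auto simp: inj_def M_ell_def)
  then have "inv (M_ell n) (a, b, c) = (a - b + real n * c, b, c)"
    by (rule inv_f_eq) (simp add: M_ell_def)
  then show ?thesis by (simp add: chart_H_def max_def)
qed

lemma dim_halfline: "u \<noteq> 0 \<Longrightarrow> dim (halfline u) = 1"
proof -
  assume u: "u \<noteq> 0"
  have "halfline u \<subseteq> span {u}" by (auto simp: halfline_def span_singleton)
  moreover have "{u} \<subseteq> halfline u" unfolding halfline_def by (auto intro: exI[of _ 1])
  ultimately show ?thesis
    using dim_subset[of "{u}" "halfline u"] dim_subset[of "halfline u" "span {u}"] u by simp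
qed

lemma trop_dim_ray: "trop_dim n (ray i) = 1"
proof -
  have "chart_H n (s *\<^sub>R u) = s *\<^sub>R chart_H n u" if "s \<ge> 0" for s u
    using that by (cases u) (simp add: chart_H_eq algebra_simps max_mult_distrib_left)
  then have "chart_H n ` ray i = halfline (chart_H n (gen i))"
    unfolding ray_eq halfline_def image_Collect by (intro Collect_cong) metis
  moreover have "gen i \<noteq> 0" "chart_H n (gen i) \<noteq> 0" by (auto simp: gen_def chart_H_eq zero_prod_def)
  ultimately show ?thesis unfolding trop_dim_def ray_eq by (simp add: dim_halfline)
qed

text \<open>Independent vectors that are fixed by \<open>chart_H n\<close> bound the spans in both charts from below, and
  a hyperplane with normal \<open>h\<close> in either chart bounds the smaller span from above. Every cell of
  dimension at least 2 contains enough vectors in the half-space \<open>b \<ge> nc\<close>, where \<open>chart_H n\<close> is the identity.\<close>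

lemma trop_dim_2:
  assumes uv: "u \<in> S" "v \<in> S" "chart_H n u = u" "chart_H n v = v" "u \<noteq> 0" "\<And>k. v \<noteq> k *\<^sub>R u"
    and flat: "h \<noteq> 0" "S \<subseteq> {x. h \<bullet> x = 0} \<or> chart_H n ` S \<subseteq> {x. h \<bullet> x = 0}"
  shows "trop_dim n S = 2"
proof -
  have "independent {u, v}" using uv(5,6)
    by (simp add: insert_commute[of u] independent_insert span_singleton) (metis rangeE)
  moreover have "u \<noteq> v" using uv(6)[of 1] by auto
  ultimately have "2 \<le> dim T" if "{u, v} \<subseteq> T" for T
    using independent_card_le_dim[OF that] by simp
  moreover have "{u, v} \<subseteq> S" "{u, v} \<subseteq> chart_H n ` S"
    using uv(1,2) imageI[OF uv(1), of "chart_H n"] imageI[OF uv(2), of "chart_H n"] uv(3,4) by simp_all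
  moreover have "dim T \<le> 2" if "T \<subseteq> {x. h \<bullet> x = 0}" for T
    using dim_subset[OF that] dim_hyperplane[OF flat(1)] by simp
  ultimately have "2 \<le> dim S" "2 \<le> dim (chart_H n ` S)" "dim S \<le> 2 \<or> dim (chart_H n ` S) \<le> 2"
    using flat(2) by blast+
  then show ?thesis unfolding trop_dim_def by linarith
qed

lemma trop_dim_3:
  assumes "u \<in> S" "v \<in> S" "w \<in> S" "chart_H n u = u" "chart_H n v = v" "chart_H n w = w"
    and "\<And>h. h \<bullet> u = 0 \<Longrightarrow> h \<bullet> v = 0 \<Longrightarrow> h \<bullet> w = 0 \<Longrightarrow> h = 0"
  shows "trop_dim n S = 3"
proof -
  have "dim T = 3" if T: "{u, v, w} \<subseteq> T" for T
  proof (rule ccontr)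
    assume "dim T \<noteq> 3"
    then have "dim T < DIM(trop)" using dim_subset_UNIV[of T] by simp
    then obtain h where "h \<noteq> 0" "span T \<subseteq> {x. h \<bullet> x = 0}" using lowdim_subset_hyperplane by blast
    then show False using T assms(7)[of h] span_base[of _ T] by blast
  qed
  moreover have "{u, v, w} \<subseteq> S" "{u, v, w} \<subseteq> chart_H n ` S"
    using assms(1-3) imageI[OF assms(1), of "chart_H n"] imageI[OF assms(2), of "chart_H n"]
      imageI[OF assms(3), of "chart_H n"] assms(4-6) by simp_all
  ultimately show ?thesis by (simp add: trop_dim_def)
qed

lemmas cell_point_simps = mem_cell chart_H_eq zero_prod_def min_def max_def distrib_left

text \<open>The faces \<open>a = 0\<close> and \<open>c = 0\<close> are flat in the identity chart. In the chart \<open>chart_H n\<close>, which adds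
  \<open>nc - min b (nc)\<close> to \<open>a\<close>, the bent face becomes \<open>a = b + nc\<close> and \<open>Pi_L\<close> becomes \<open>a = nc\<close>; this
  is where the normal vectors come from.\<close>

lemma trop_dim_cell_L:
  assumes "n \<ge> 1"
  shows "trop_dim n (cell_L n f) = cell_dim f"
proof (cases f)
  case FaceAB
  show ?thesis unfolding FaceAB cell_dim.simps
    by (rule trop_dim_2[of "(1, 1, 0)" _ "(0, 1, 0)" _ "(0, 0, 1)"])
      (use assms in
        \<open>auto simp: cell_point_simps split: if_splits simp del: cell_L.simps cell_R.simps\<close>)
next
  case FaceAT
  show ?thesis unfolding FaceAT cell_dim.simps
    by (rule trop_dim_2[of "(1, 1, 0)" _ "(2 * n, n, 1)" _ "(1, -1, - n)"])
      (use assms in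
        \<open>auto simp: cell_point_simps split: if_splits simp del: cell_L.simps cell_R.simps\<close>)
next
  case FaceBT
  show ?thesis unfolding FaceBT cell_dim.simps
    by (rule trop_dim_2[of "(0, 1, 0)" _ "(0, n, 1)" _ "(1, 0, 0)"])
      (use assms in
        \<open>auto simp: cell_point_simps split: if_splits simp del: cell_L.simps cell_R.simps\<close>)
next
  case Wall
  show ?thesis unfolding Wall cell_dim.simps
    by (rule trop_dim_2[of "(0, 1, 0)" _ "(n, n, 1)" _ "(1, 0, - n)"])
      (use assms in
        \<open>auto simp: cell_point_simps split: if_splits simp del: cell_L.simps cell_R.simps\<close>)
next
  case ChamberABT
  show ?thesis unfolding ChamberABT cell_dim.simps
    by (rule trop_dim_3[of "(0, 1, 0)" _ "(1, 1, 0)" "(n, n, 1)"])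
      (use assms in
        \<open>auto simp: cell_point_simps split: if_splits simp del: cell_L.simps cell_R.simps\<close>)
next
  case ChamberBT
  show ?thesis unfolding ChamberBT cell_dim.simps
    by (rule trop_dim_3[of "(0, 1, 0)" _ "(0, n, 1)" "(n, n, 1)"])
      (use assms in
        \<open>auto simp: cell_point_simps split: if_splits simp del: cell_L.simps cell_R.simps\<close>)
qed (use trop_dim_ray in simp_all)

lemma trop_dim_cell_R:
  assumes "n \<ge> 1"
  shows "trop_dim n (cell_R n f) = cell_dim f"
proof (cases f)
  case Wall
  show ?thesis unfolding Wall cell_dim.simps
    by (rule trop_dim_2[of "(1, 1, 0)" _ "(n, n, 1)" _ "(1, -1, 0)"])
      (use assms in
        \<open>auto simp: cell_point_simps split: if_splits simp del: cell_L.simps cell_R.simps\<close>)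
next
  case ChamberABT
  show ?thesis unfolding ChamberABT cell_dim.simps
    by (rule trop_dim_3[of "(0, 1, 0)" _ "(1, 1, 0)" "(0, n, 1)"])
      (use assms in
        \<open>auto simp: cell_point_simps split: if_splits simp del: cell_L.simps cell_R.simps\<close>)
next
  case ChamberBT
  show ?thesis unfolding ChamberBT cell_dim.simps
    by (rule trop_dim_3[of "(1, 1, 0)" _ "(n, n, 1)" "(n + 1, n, 1)"])
      (use assms in
        \<open>auto simp: cell_point_simps add_eq_0_iff split: if_splits simp del: cell_L.simps cell_R.simps\<close>)
qed (use trop_dim_ray trop_dim_cell_L[OF assms, of FaceAB] trop_dim_cell_L[OF assms, of FaceAT]
      trop_dim_cell_L[OF assms, of FaceBT] in simp_all)


section \<open>The duality\<close>

theorem theorem2p8: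
  fixes n :: nat
  assumes "n \<ge> 1"
  shows "trop_sigma n = tau1 n \<union> tau2 n \<and>
    (\<exists>\<phi>. duality n (cells_L n) {1, 2, 3} (\<lambda>i. strict_transform (X n) (D n i)) \<phi> \<and>
         (\<forall>i\<in>{1, 2, 3}. \<phi> (ray i) = strict_transform (X n) (D n i)) \<and>
         \<phi> (Pi_L n) = fibre_P (X n)) \<and>
    (\<exists>\<phi>. duality n (cells_R n) {1, 2, 3} (\<lambda>i. strict_transform (X' n) (D n i)) \<phi> \<and>
         (\<forall>i\<in>{1, 2, 3}. \<phi> (ray i) = strict_transform (X' n) (D n i)))"
proof (intro conjI)
  have "tau1 n \<subseteq> trop_sigma n"
  proof clarify
    fix a b c assume "(a, b, c) \<in> tau1 n"
    then have *: "0 \<le> a" "a \<le> b" "a \<le> real n * c" by (simp_all add: mem_tau1[OF assms])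
    then have "0 \<le> real n * c" by linarith
    then have "0 \<le> c" using assms by (simp add: zero_le_mult_iff)
    then show "(a, b, c) \<in> trop_sigma n" using * by (simp add: mem_trop_sigma)
  qed
  then show "trop_sigma n = tau1 n \<union> tau2 n"
    using closure_subset[of "trop_sigma n - tau1 n"] tau2_eq[OF assms] unfolding tau2_def by blast
next
  let ?E = "\<lambda>i. strict_transform (X n) (D n i)"
  note E = strict_transform_D1[OF assms] strict_transform_D2[OF assms] strict_transform_D3[OF assms]
  have "\<exists>\<phi>. duality n (range (cell_L n)) {1, 2, 3} ?E \<phi> \<and> (\<forall>f. \<phi> (cell_L n f) = stratum n f)"
  proof (rule duality_of_labelling)
    show "cell_L n f \<subseteq> cell_L n g \<longleftrightarrow> stratum n g \<subseteq> stratum n f" for f g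
      by (simp only: cell_L_subset_iff[OF assms] stratum_subset_iff[OF assms])
    show "trop_dim n (cell_L n f) = cell_dim f" for f by (rule trop_dim_cell_L[OF assms])
    show "strata {1, 2, 3} ?E k = stratum n ` {f. cell_dim f = 3 - k}" if "k \<le> 2" for k
      using strata_stratum[OF assms, of ?E 1 2] E that by simp
  qed
  then obtain \<phi> where dual: "duality n (range (cell_L n)) {1, 2, 3} ?E \<phi>"
    and \<phi>: "\<And>f. \<phi> (cell_L n f) = stratum n f" by blast
  show "\<exists>\<phi>. duality n (cells_L n) {1, 2, 3} ?E \<phi> \<and> (\<forall>i\<in>{1, 2, 3}. \<phi> (ray i) = ?E i) \<and>
      \<phi> (Pi_L n) = fibre_P (X n)"
  proof (intro exI[of _ \<phi>] conjI)
    show "duality n (cells_L n) {1, 2, 3} ?E \<phi>" unfolding cells_L_eq by (rule dual)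
    show "\<forall>i\<in>{1, 2, 3}. \<phi> (ray i) = ?E i"
      using \<phi>[of RayA] \<phi>[of RayB] \<phi>[of RayT] E by simp
    show "\<phi> (Pi_L n) = fibre_P (X n)" using \<phi>[of Wall] fibre_P_X[OF assms] by simp
  qed
next
  let ?E = "\<lambda>i. strict_transform (X' n) (D n i)"
  let ?F = "\<lambda>i. mirror ` ?E i"
  let ?S = "\<lambda>f. mirror ` stratum n f"
  note X' = X'_eq_mirror[OF assms]
  have E: "?E 1 = ?S RayB" "?E 2 = ?S RayA" "?E 3 = ?S RayT"
    unfolding X'
    using strict_transform_mirror[OF strict_transform_D2[OF assms] zariski_closed_stratum flip_D(2)]
      strict_transform_mirror[OF strict_transform_D1[OF assms] zariski_closed_stratum flip_D(1)]
      strict_transform_mirror[OF strict_transform_D3[OF assms] zariski_closed_stratum flip_D(3)]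
    by this+
  have "\<exists>\<phi>. duality n (range (cell_R n)) {1, 2, 3} ?E \<phi> \<and> (\<forall>f. \<phi> (cell_R n f) = ?S f)"
  proof (rule duality_of_labelling)
    show "cell_R n f \<subseteq> cell_R n g \<longleftrightarrow> ?S g \<subseteq> ?S f" for f g
      by (simp only: cell_R_subset_iff[OF assms] stratum_subset_iff[OF assms]
          inj_image_subset_iff[OF inj_mirror])
    show "trop_dim n (cell_R n f) = cell_dim f" for f by (rule trop_dim_cell_R[OF assms])
    show "strata {1, 2, 3} ?E k = ?S ` {f. cell_dim f = 3 - k}" if "k \<le> 2" for k
    proof -
      \<comment> \<open>Reflecting back gives the divisors of \<open>X\<close>, with the indices 1 and 2 exchanged.\<close>
      have "strata {1, 2, 3} ?F k = stratum n ` {f. cell_dim f = 3 - k}"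
        using strata_stratum[OF assms, of ?F 2 1] E that by (simp add: insert_commute)
      moreover have "?E = (\<lambda>i. mirror ` ?F i)" by simp
      ultimately show ?thesis using strata_mirror[of "{1, 2, 3}" ?F k] by (simp add: image_image)
    qed
  qed
  then obtain \<phi> where dual: "duality n (range (cell_R n)) {1, 2, 3} ?E \<phi>"
    and \<phi>: "\<And>f. \<phi> (cell_R n f) = ?S f" by blast
  show "\<exists>\<phi>. duality n (cells_R n) {1, 2, 3} ?E \<phi> \<and> (\<forall>i\<in>{1, 2, 3}. \<phi> (ray i) = ?E i)"
  proof (intro exI[of _ \<phi>] conjI)
    show "duality n (cells_R n) {1, 2, 3} ?E \<phi>" unfolding cells_R_eq by (rule dual)
    show "\<forall>i\<in>{1, 2, 3}. \<phi> (ray i) = ?E i"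
      using \<phi>[of RayA] \<phi>[of RayB] \<phi>[of RayT] E by simp
  qed
qed

end
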